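(* For integers $n\ge 2$ and $H\ge 2$ there are constants $c_n,C_n>0$ depending only on $n$ such that: $c_2 H\log H\le R^*_2(H)\le C_2 H\log H$; $c_3 H^2\log H\le R^*_3(H)\le C_3 H^2\log H$; and for $n\ge 4$, $c_n H^{n-1}\le R^*_n(H)\le C_n H^{n-1}$.
   Context: A polynomial $f\in\mathbb{C}[X]$ is degenerate if it has two distinct roots whose quotient is a root of unity. $S^*_n(H)$ is the set of polynomials $a_0X^n+\dots+a_n\in\mathbb{Z}[X]$ with $a_0\ne0$, degenerate, and $|a_j|\le H$ for $j=0,\dots,n$. A polynomial in $\mathbb{Z}[X]$ is called reducible if it is reducible in $\mathbb{Q}[X]$. $R^*_n(H)$ is the number of reducible polynomials in $S^*_n(H)$. *)

theory Defs
  imports Complex_Main "HOL-Computational_Algebra.Computational_Algebra"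
begin

text \<open>Division by \<open>0\<close> yields \<open>0\<close> in HOL, which is not a root of unity, so the root \<open>0\<close> never
  takes part in a degenerate pair.\<close>

definition degenerate :: "complex poly \<Rightarrow> bool" where
  "degenerate f \<longleftrightarrow>
     (\<exists>x y. poly f x = 0 \<and> poly f y = 0 \<and> x \<noteq> y \<and> (\<exists>k>0. (x / y) ^ k = 1))"

definition reducible_over_rat :: "int poly \<Rightarrow> bool" where
  "reducible_over_rat f \<longleftrightarrow>
     (let g = map_poly of_int f :: rat poly in g \<noteq> 0 \<and> \<not> is_unit g \<and> \<not> irreducible g)"

definition degenerate_polys :: "nat \<Rightarrow> nat \<Rightarrow> int poly set" where
  "degenerate_polys n H =
     {f. degree f \<le> n \<and> coeff f n \<noteq> 0 \<and> degenerate (map_poly of_int f) \<and>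
         (\<forall>j\<le>n. \<bar>coeff f j\<bar> \<le> int H)}"

text \<open>\<open>degenerate_polys n H\<close> is \<open>S*\<^sub>n(H)\<close>; the following is \<open>R*\<^sub>n(H)\<close>.\<close>

definition R_star :: "nat \<Rightarrow> nat \<Rightarrow> nat" where
  "R_star n H = card {f \<in> degenerate_polys n H. reducible_over_rat f}"

end

theory Submission
  imports Defs "Berlekamp_Zassenhaus.Factor_Bound" "HOL-Analysis.Harmonic_Numbers"
begin

text \<open>
  Upper bound for \<open>n \<ge> 3\<close>: a reducible \<open>f\<close> factors over the integers as \<open>p * q\<close>, and the product of
  the heights of \<open>p\<close> and \<open>q\<close> is \<open>O(H)\<close> by multiplicativity of the Mahler measure. If \<open>f\<close> is
  degenerate, then after swapping the factors \<open>deg q \<ge> 2\<close> and there is a root of unity \<open>z \<noteq> 1\<close> such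
  that \<open>q\<close> has roots \<open>x\<close> and \<open>z * x\<close>, or \<open>p\<close> has a root \<open>x\<close> and \<open>q\<close> the root \<open>z * x\<close>. Only
  finitely many \<open>z\<close> occur for given \<open>n\<close>, and either condition costs \<open>q\<close> one degree of freedom, so with
  \<open>a = deg p\<close> and \<open>M\<close> the height of \<open>p\<close> the count is at most a constant times
  \<open>\<Sum>M\<le>T. M\<^sup>a (T/M)\<^bsup>n-a\<^esup>\<close> with \<open>T = O(H)\<close>. The only sum exceeding \<open>T\<^bsup>n-1\<^esup>\<close> is \<open>a = 1\<close>, \<open>n = 3\<close>,
  which is harmonic.

  In degree 2 degeneracy forces \<open>f = m (u\<^sup>2 X\<^sup>2 - v\<^sup>2)\<close>. The lower bounds come from such polynomials,
  from \<open>(a X\<^sup>2 + c) (r X + s)\<close>, and from multiples of \<open>X\<^sup>2 + 1\<close>.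
\<close>

hide_const (open) up_ring.coeff up_ring.monom module.smult comm_monoid_mult_class.coprime

section \<open>Counting integer polynomials in a box\<close>

definition coeff_box :: "nat \<Rightarrow> nat \<Rightarrow> int poly set" where
  "coeff_box d M = {f. degree f \<le> d \<and> (\<forall>j. \<bar>coeff f j\<bar> \<le> int M)}"

lemma restrict_coeff_in_PiE:
  assumes "J \<subseteq> {..d}"
  shows "(\<lambda>f. restrict (coeff f) J) ` coeff_box d M \<subseteq> (\<Pi>\<^sub>E i\<in>J. {- int M..int M})"
  by (auto simp: coeff_box_def restrict_PiE_iff abs_le_iff minus_le_iff)

lemma finite_coeff_box: "finite (coeff_box d M)"
proof (rule inj_on_finite)
  show "inj_on (\<lambda>f. restrict (coeff f) {..d}) (coeff_box d M)"
  proof (rule inj_onI, rule poly_eqI)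
    fix f g i assume fg: "f \<in> coeff_box d M" "g \<in> coeff_box d M"
      "restrict (coeff f) {..d} = restrict (coeff g) {..d}"
    show "coeff f i = coeff g i"
    proof (cases "i \<le> d")
      case True
      then show ?thesis using fun_cong[OF fg(3), of i] by simp
    next
      case False
      then show ?thesis using fg(1,2) by (simp add: coeff_box_def coeff_eq_0)
    qed
  qed
  show "(\<lambda>f. restrict (coeff f) {..d}) ` coeff_box d M \<subseteq> (\<Pi>\<^sub>E i\<in>{..d}. {- int M..int M})"
    by (rule restrict_coeff_in_PiE) simp
  show "finite (\<Pi>\<^sub>E i\<in>{..d}. {- int M..int M})"
    by (rule finite_PiE) auto
qed

text \<open>Forgetting coefficient \<open>j\<close> maps \<open>A\<close> into a box with
  \<open>(2 * M + 1) ^ d\<close> points, and \<open>K\<close> bounds the fibres of this map.\<close>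

lemma card_coeff_box_fibre_le:
  assumes A: "A \<subseteq> coeff_box d M" and j: "j \<le> d"
    and K: "\<And>f. f \<in> A \<Longrightarrow> card {g \<in> A. \<forall>i. i \<noteq> j \<longrightarrow> coeff g i = coeff f i} \<le> K"
  shows "card A \<le> K * (2 * M + 1) ^ d"
proof -
  define t where "t = (\<lambda>f :: int poly. restrict (coeff f) ({..d} - {j}))"
  have fin: "finite A" using A finite_coeff_box finite_subset by blast
  have tA: "t ` A \<subseteq> (\<Pi>\<^sub>E i\<in>{..d} - {j}. {- int M..int M})"
    unfolding t_def by (rule order_trans[OF image_mono[OF A] restrict_coeff_in_PiE]) auto
  have "card (t ` A) \<le> card (\<Pi>\<^sub>E i\<in>{..d} - {j}. {- int M..int M})"
    by (rule card_mono[OF finite_PiE tA]) auto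
  also have "\<dots> = (2 * M + 1) ^ d"
    using j by (simp add: card_PiE nat_add_distrib nat_mult_distrib)
  finally have card_t: "card (t ` A) \<le> (2 * M + 1) ^ d" .
  have "card A = card (\<Union>s\<in>t ` A. {g \<in> A. t g = s})"
    by (rule arg_cong[where f = card]) auto
  also have "\<dots> \<le> (\<Sum>s\<in>t ` A. card {g \<in> A. t g = s})"
    using fin by (intro card_UN_le) simp
  also have "\<dots> \<le> (\<Sum>s\<in>t ` A. K)"
  proof (rule sum_mono)
    fix s assume "s \<in> t ` A"
    then obtain f where f: "f \<in> A" "s = t f" by auto
    have "{g \<in> A. t g = s} \<subseteq> {g \<in> A. \<forall>i. i \<noteq> j \<longrightarrow> coeff g i = coeff f i}"
    proof (safe)
      fix g i assume g: "g \<in> A" "s = t g" "i \<noteq> j"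
      show "coeff g i = coeff f i"
      proof (cases "i \<le> d")
        case True
        have "t g i = t f i" using g f by simp
        with True g show ?thesis by (simp add: t_def)
      next
        case False
        moreover have "degree f \<le> d" "degree g \<le> d" using A f g by (auto simp: coeff_box_def)
        ultimately show ?thesis by (simp add: coeff_eq_0)
      qed
    qed
    then have "card {g \<in> A. t g = s} \<le> card {g \<in> A. \<forall>i. i \<noteq> j \<longrightarrow> coeff g i = coeff f i}"
      using fin by (intro card_mono) auto
    then show "card {g \<in> A. t g = s} \<le> K" using K[OF f(1)] by linarith
  qed
  also have "\<dots> = K * card (t ` A)" by simp
  also have "\<dots> \<le> K * (2 * M + 1) ^ d" using card_t by simp
  finally show ?thesis .
qed

text \<open>Fibres with one element: a condition that determines coefficient \<open>j\<close> from
  the others saves a factor \<open>2 * M + 1\<close>.\<close>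

lemma card_coeff_box_slice_le:
  assumes A: "A \<subseteq> coeff_box d M" and j: "j \<le> d"
    and inj: "\<And>f g. \<lbrakk>f \<in> A; g \<in> A; \<And>i. i \<noteq> j \<Longrightarrow> coeff f i = coeff g i\<rbrakk> \<Longrightarrow> f = g"
  shows "card A \<le> (2 * M + 1) ^ d"
proof -
  have "card {g \<in> A. \<forall>i. i \<noteq> j \<longrightarrow> coeff g i = coeff f i} \<le> 1" if "f \<in> A" for f
  proof -
    have "{g \<in> A. \<forall>i. i \<noteq> j \<longrightarrow> coeff g i = coeff f i} \<subseteq> {f}"
      using inj[OF _ that] by blast
    then show ?thesis using card_mono[of "{f}"] by fastforce
  qed
  from card_coeff_box_fibre_le[OF A j this] show ?thesis by simp
qed

lemma card_coeff_box_coeff_eq_le: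
  assumes "j \<le> d"
  shows "card {f \<in> coeff_box d M. coeff f j = c} \<le> (2 * M + 1) ^ d"
proof (rule card_coeff_box_slice_le[OF _ assms])
  fix f g assume "f \<in> {f \<in> coeff_box d M. coeff f j = c}" "g \<in> {f \<in> coeff_box d M. coeff f j = c}"
    and "\<And>i. i \<noteq> j \<Longrightarrow> coeff f i = coeff g i"
  then show "f = g" by (metis (mono_tags, lifting) mem_Collect_eq poly_eqI)
qed auto

text \<open>Vanishing at \<open>x\<close> is a linear condition in which the constant coefficient
  has factor 1, so the other coefficients determine it.\<close>

lemma card_coeff_box_root_le:
  fixes x :: complex
  shows "card {f \<in> coeff_box d M. poly (map_poly of_int f) x = 0} \<le> (2 * M + 1) ^ d"
proof (rule card_coeff_box_slice_le[of _ _ _ 0])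
  fix f g
  assume f: "f \<in> {f \<in> coeff_box d M. poly (map_poly of_int f) x = 0}"
    and g: "g \<in> {f \<in> coeff_box d M. poly (map_poly of_int f) x = 0}"
    and eq: "\<And>i. i \<noteq> 0 \<Longrightarrow> coeff f i = coeff g i"
  have "map_poly of_int f = map_poly of_int g + [:of_int (coeff f 0 - coeff g 0) :: complex:]"
    by (rule poly_eqI) (auto simp: coeff_map_poly coeff_pCons eq split: nat.splits)
  then have "of_int (coeff f 0 - coeff g 0) = (0 :: complex)" using f g by simp
  then have "coeff f 0 = coeff g 0" by (simp only: of_int_eq_0_iff)
  with eq show "f = g" by (metis poly_eqI)
qed auto

text \<open>A common root of \<open>f(X)\<close> and \<open>f(zX)\<close> is a root of \<open>f(zX) - f(X)\<close>, which does not involve the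
  constant coefficient of \<open>f\<close>; so this coefficient takes at most \<open>d\<close> values once the others are fixed,
  unless the difference vanishes. The latter forces \<open>coeff f 1 = 0\<close>.\<close>

lemma card_coeff_box_twisted_root_le:
  fixes z :: complex
  assumes z: "z \<noteq> 1" and d: "1 \<le> d"
  shows "card {f \<in> coeff_box d M. \<exists>x. poly (map_poly of_int f) x = 0 \<and> poly (map_poly of_int f) (z * x) = 0}
           \<le> (d + 1) * (2 * M + 1) ^ d" (is "card ?A \<le> _")
proof -
  let ?B = "{f \<in> ?A. coeff f 1 \<noteq> 0}" and ?C = "{f \<in> coeff_box d M. coeff f 1 = 0}"
  have "card ?B \<le> d * (2 * M + 1) ^ d"
  proof (rule card_coeff_box_fibre_le[of _ _ _ 0])
    fix f assume f: "f \<in> ?B"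
    let ?p = "\<lambda>f. map_poly of_int f :: complex poly"
    define q where "q = ?p f \<circ>\<^sub>p [:0, z:] - ?p f"
    have const: "poly r 0 = coeff r 0" for r :: "complex poly" by (simp add: poly_0_coeff_0)
    have cq: "coeff q i = (z ^ i - 1) * of_int (coeff f i)" for i
      by (simp add: q_def coeff_pcompose_linear coeff_map_poly algebra_simps)
    have "coeff q 1 \<noteq> 0" using f z by (simp add: cq)
    then have q0: "q \<noteq> 0" by auto
    have dq: "degree q \<le> d"
      using f by (intro degree_le) (auto simp: cq coeff_box_def coeff_eq_0)
    define F where "F = {g \<in> ?B. \<forall>i. i \<noteq> 0 \<longrightarrow> coeff g i = coeff f i}"
    have "\<forall>g\<in>F. \<exists>x. poly (?p g) x = 0 \<and> poly q x = 0"
    proof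
      fix g assume g: "g \<in> F"
      then obtain x where x: "poly (?p g) x = 0" "poly (?p g) (z * x) = 0"
        by (auto simp: F_def)
      have "q = ?p g \<circ>\<^sub>p [:0, z:] - ?p g"
      proof (rule poly_eqI)
        fix i
        show "coeff q i = coeff (?p g \<circ>\<^sub>p [:0, z:] - ?p g) i"
          using g by (cases "i = 0") (simp_all add: F_def cq const coeff_pcompose_linear coeff_map_poly algebra_simps)
      qed
      then have "poly q x = 0" using x by (simp add: poly_pcompose mult.commute)
      with x show "\<exists>x. poly (?p g) x = 0 \<and> poly q x = 0" by auto
    qed
    then obtain h where h: "\<And>g. g \<in> F \<Longrightarrow> poly (?p g) (h g) = 0 \<and> poly q (h g) = 0"
      by metis
    \<comment> \<open>Two members of \<open>F\<close> differ by a constant, so sharing a root makes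
      them equal. Hence \<open>F\<close> is no larger than the root set of \<open>q\<close>.\<close>
    have "inj_on h F"
    proof (rule inj_onI)
      fix g g' assume g: "g \<in> F" "g' \<in> F" "h g = h g'"
      have "?p g = ?p g' + [:of_int (coeff g 0 - coeff g' 0):]"
        using g by (intro poly_eqI) (auto simp: F_def coeff_map_poly coeff_pCons split: nat.splits)
      then have "of_int (coeff g 0 - coeff g' 0) = (0 :: complex)"
        using h[OF g(1)] h[OF g(2)] g(3) by simp
      then have "coeff g 0 = coeff g' 0" by (simp only: of_int_eq_0_iff)
      moreover have "coeff g i = coeff g' i" if "i \<noteq> 0" for i using g that by (simp add: F_def)
      ultimately show "g = g'" by (metis poly_eqI)
    qed
    then have "card F \<le> card {x. poly q x = 0}"
      using h poly_roots_finite[OF q0] by (intro card_inj_on_le[of h]) auto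
    also have "\<dots> \<le> d" using card_poly_roots_bound[OF q0] dq by linarith
    finally show "card {g \<in> ?B. \<forall>i. i \<noteq> 0 \<longrightarrow> coeff g i = coeff f i} \<le> d" by (simp add: F_def)
  qed auto
  moreover have "card ?C \<le> (2 * M + 1) ^ d"
    by (rule card_coeff_box_coeff_eq_le[OF d])
  moreover have "card ?A \<le> card (?B \<union> ?C)"
    by (rule card_mono) (auto intro: finite_subset[OF _ finite_coeff_box])
  moreover have "card (?B \<union> ?C) \<le> card ?B + card ?C" by (rule card_Un_le)
  ultimately show ?thesis by simp
qed

text \<open>Index \<open>0\<close> always occurs, so \<open>Max\<close> is taken over a nonempty
  set, and the zero polynomial gets height 0.\<close>

definition naive_height :: "int poly \<Rightarrow> nat" where
  "naive_height f = Max ((\<lambda>j. nat \<bar>coeff f j\<bar>) ` {..degree f})"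

lemma abs_coeff_le_naive_height: "\<bar>coeff f j\<bar> \<le> int (naive_height f)"
proof (cases "j \<le> degree f")
  case True
  then have "nat \<bar>coeff f j\<bar> \<le> naive_height f" unfolding naive_height_def by (intro Max_ge) auto
  then show ?thesis by linarith
qed (simp add: coeff_eq_0)

lemma naive_height_attained: "\<exists>j\<le>degree f. \<bar>coeff f j\<bar> = int (naive_height f)"
proof -
  have "naive_height f \<in> (\<lambda>j. nat \<bar>coeff f j\<bar>) ` {..degree f}"
    unfolding naive_height_def by (intro Max_in) auto
  then show ?thesis by auto
qed

lemma naive_height_pos: "f \<noteq> 0 \<Longrightarrow> 0 < naive_height f"
  using abs_coeff_le_naive_height[of f "degree f"] leading_coeff_0_iff[of f] by (intro gr0I) auto

text \<open>One of the \<open>a + 1\<close> coefficients is \<open>M\<close> or \<open>-M\<close>;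
  fixing its position and sign leaves \<open>a\<close> free ones. This gives the exponent
  \<open>a\<close>, not \<open>a + 1\<close>, in the later sums over \<open>M\<close>.\<close>

lemma card_naive_height_eq_le:
  "card {f. degree f = a \<and> naive_height f = M} \<le> 2 * (a + 1) * (2 * M + 1) ^ a"
proof -
  let ?S = "\<lambda>j c. {f \<in> coeff_box a M. coeff f j = c}"
  have "card {f. degree f = a \<and> naive_height f = M}
          \<le> card (\<Union>j\<in>{..a}. ?S j (int M) \<union> ?S j (- int M))"
  proof (rule card_mono)
    show "finite (\<Union>j\<in>{..a}. ?S j (int M) \<union> ?S j (- int M))"
      using finite_coeff_box by (auto intro: finite_subset)
    show "{f. degree f = a \<and> naive_height f = M} \<subseteq> (\<Union>j\<in>{..a}. ?S j (int M) \<union> ?S j (- int M))"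
    proof
      fix f assume f: "f \<in> {f. degree f = a \<and> naive_height f = M}"
      then have "f \<in> coeff_box a M" using abs_coeff_le_naive_height by (auto simp: coeff_box_def)
      with f naive_height_attained[of f]
      show "f \<in> (\<Union>j\<in>{..a}. ?S j (int M) \<union> ?S j (- int M))" by (force simp: abs_if split: if_splits)
    qed
  qed
  also have "\<dots> \<le> (\<Sum>j\<in>{..a}. card (?S j (int M) \<union> ?S j (- int M)))"
    by (rule card_UN_le) auto
  also have "\<dots> \<le> (\<Sum>j\<in>{..a}. (2 * M + 1) ^ a + (2 * M + 1) ^ a)"
    by (intro sum_mono order_trans[OF card_Un_le] add_mono card_coeff_box_coeff_eq_le) auto
  also have "\<dots> = 2 * (a + 1) * (2 * M + 1) ^ a" by simp
  finally show ?thesis .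
qed

section \<open>Mahler measure and integral factorizations\<close>

lemma mahler_measure_mult: "mahler_measure (f * g) = mahler_measure f * mahler_measure g"
  by (simp add: mahler_measure_def measure_eq_prod of_int_poly_hom.hom_mult)

text \<open>Mignotte's bound, with the binomial coefficients estimated by
  \<open>2 ^ degree f\<close>.\<close>

lemma naive_height_le_mahler_measure: "real (naive_height f) \<le> 2 ^ degree f * mahler_measure f"
proof -
  obtain j where j: "j \<le> degree f" "\<bar>coeff f j\<bar> = int (naive_height f)"
    using naive_height_attained by blast
  have "real (naive_height f) = real_of_int \<bar>coeff f j\<bar>" by (simp add: j)
  also have "\<dots> \<le> (degree f choose j) * mahler_measure f" by (rule Mignotte_bound)
  also have "\<dots> \<le> 2 ^ degree f * mahler_measure f"
    using binomial_le_pow2[of "degree f" j] mahler_measure_ge_0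
    by (intro mult_right_mono) (simp_all flip: of_nat_power)
  finally show ?thesis .
qed

text \<open>Landau's inequality bounds the Mahler measure by the Euclidean norm of the at most
  \<open>n + 1\<close> coefficients. The resulting factor \<open>sqrt (n + 1)\<close> is weakened to
  \<open>n + 1\<close>.\<close>

lemma mahler_measure_le_naive_height:
  assumes "degree f \<le> n"
  shows "mahler_measure f \<le> real (n + 1) * real (naive_height f)"
proof -
  let ?f = "map_poly of_int f :: complex poly" and ?h = "real (naive_height f)"
  have "(\<Sum>a\<leftarrow>coeffs ?f. (cmod a)\<^sup>2) \<le> (\<Sum>a\<leftarrow>coeffs ?f. ?h\<^sup>2)"
  proof (rule sum_list_mono)
    fix a assume "a \<in> set (coeffs ?f)"
    then obtain j where "a = coeff ?f j" by (auto simp: coeffs_def split: if_splits)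
    then have "cmod a = real_of_int \<bar>coeff f j\<bar>" by (simp add: coeff_map_poly)
    also have "\<dots> \<le> ?h" using abs_coeff_le_naive_height[of f j] by linarith
    finally show "(cmod a)\<^sup>2 \<le> ?h\<^sup>2" by (simp add: power_mono)
  qed
  also have "\<dots> = real (length (coeffs ?f)) * ?h\<^sup>2" by (rule sum_list_triv)
  also have "\<dots> \<le> real (n + 1) * ?h\<^sup>2"
    using assms by (intro mult_right_mono) (auto simp: length_coeffs degree_map_poly coeffs_def)
  also have "\<dots> \<le> (real (n + 1) * ?h)\<^sup>2"
    by (simp add: power_mult_distrib mult_right_mono self_le_power)
  finally have "sqrt (\<Sum>a\<leftarrow>coeffs ?f. (cmod a)\<^sup>2) \<le> real (n + 1) * ?h"
    by (intro real_le_lsqrt) auto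
  then show ?thesis using Landau_inequality[of ?f] by (simp add: mahler_measure_def)
qed

text \<open>The height is not multiplicative but the Mahler measure is; passing to it and back costs
  only factors depending on \<open>n\<close>.\<close>

lemma naive_height_mult_le:
  assumes n: "degree p + degree q \<le> n"
  shows "naive_height p * naive_height q \<le> 2 ^ n * (n + 1) * naive_height (p * q)"
proof -
  have "real (naive_height p) * real (naive_height q)
          \<le> (2 ^ degree p * mahler_measure p) * (2 ^ degree q * mahler_measure q)"
    by (intro mult_mono naive_height_le_mahler_measure)
       (auto intro!: mult_nonneg_nonneg mahler_measure_ge_0)
  also have "\<dots> = 2 ^ (degree p + degree q) * mahler_measure (p * q)"
    by (simp add: mahler_measure_mult power_add)
  also have "\<dots> \<le> 2 ^ n * mahler_measure (p * q)"
    using n by (intro mult_right_mono power_increasing mahler_measure_ge_0) auto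
  also have "\<dots> \<le> 2 ^ n * (real (n + 1) * real (naive_height (p * q)))"
    using n degree_mult_le[of p q]
    by (intro mult_left_mono mahler_measure_le_naive_height) auto
  also have "\<dots> = real (2 ^ n * (n + 1) * naive_height (p * q))" by (simp add: algebra_simps)
  finally show ?thesis by (metis of_nat_le_iff of_nat_mult)
qed

text \<open>Gauss's lemma: a rational factorization can be rescaled to an integral one with the same
  degrees.\<close>

lemma reducible_over_rat_factor:
  assumes "reducible_over_rat f"
  obtains p q where "f = p * q" "0 < degree p" "0 < degree q"
proof -
  let ?g = "map_poly of_int f :: rat poly"
  have g: "?g \<noteq> 0" "\<not> is_unit ?g" "\<not> irreducible ?g"
    using assms by (auto simp: reducible_over_rat_def Let_def)
  then obtain a b where ab: "?g = a * b" "\<not> is_unit a" "\<not> is_unit b"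
    by (auto simp: irreducible_def)
  moreover have "a \<noteq> 0" "b \<noteq> 0" using g ab by auto
  ultimately have "0 < degree a" "0 < degree b" by (auto simp: is_unit_iff_degree)
  moreover obtain p q where "f = p * q" "degree p = degree a" "degree q = degree b"
    using rat_to_int_factor[OF ab(1)] by blast
  ultimately show ?thesis using that by metis
qed

text \<open>Over the rationals nonzero constants are units, so positive degree is what makes a
  factor a non-unit.\<close>

lemma reducible_over_rat_mult:
  assumes "0 < degree p" "0 < degree q"
  shows "reducible_over_rat (p * q)"
proof -
  let ?p = "map_poly of_int p :: rat poly" and ?q = "map_poly of_int q :: rat poly"
  have deg: "0 < degree ?p" "0 < degree ?q" using assms by (auto simp: degree_map_poly)
  have nz: "?p \<noteq> 0" "?q \<noteq> 0" using deg by auto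
  have "\<not> is_unit ?p" "\<not> is_unit ?q" "\<not> is_unit (?p * ?q)"
    using deg nz by (auto simp: is_unit_iff_degree degree_mult_eq)
  moreover from this have "\<not> irreducible (?p * ?q)" using irreducibleD by blast
  ultimately show ?thesis
    using nz unfolding reducible_over_rat_def Let_def of_int_poly_hom.hom_mult by simp
qed

section \<open>Roots of unity as quotients of two roots\<close>

text \<open>Reducing \<open>X ^ s\<close> modulo \<open>F\<close> does not change its value at the
  root \<open>x\<close>.\<close>

lemma power_eq_poly_less_degree:
  fixes F :: "rat poly" and x :: complex
  assumes root: "poly (map_poly of_rat F) x = 0" and deg: "0 < degree F"
  obtains c :: "nat \<Rightarrow> rat" where "x ^ s = (\<Sum>i<degree F. of_rat (c i) * x ^ i)"
proof -
  interpret of_rat_hom: field_char_0_hom "of_rat :: rat \<Rightarrow> complex" ..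
  interpret h: map_poly_comm_ring_hom "of_rat :: rat \<Rightarrow> complex" ..
  define r where "r = monom 1 s mod F"
  have F0: "F \<noteq> 0" using deg by auto
  have "poly (map_poly of_rat (monom 1 s div F * F + r)) x = poly (map_poly of_rat r) x"
    using root by (simp add: h.hom_add h.hom_mult)
  then have "x ^ s = poly (map_poly of_rat r) x"
    by (simp add: r_def map_poly_monom poly_monom)
  also have "\<dots> = (\<Sum>i\<le>degree r. of_rat (coeff r i) * x ^ i)"
    by (simp add: poly_altdef coeff_map_poly degree_map_poly)
  also have "\<dots> = (\<Sum>i<degree F. of_rat (coeff r i) * x ^ i)"
  proof (cases "r = 0")
    case False
    then have "degree r < degree F" using degree_mod_less[OF F0, of "monom 1 s"] by (auto simp: r_def)
    then show ?thesis by (intro sum.mono_neutral_left) (auto simp: coeff_eq_0)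
  qed (use deg in simp)
  finally show ?thesis using that by blast
qed

text \<open>Clears denominators: the rational polynomial with coefficients \<open>c t\<close> is a
  nonzero rational multiple of an integer polynomial of the same degree.\<close>

lemma rat_dependence_imp_int_poly:
  assumes "\<exists>t\<le>D. c t \<noteq> 0" and "(\<Sum>t\<le>D. of_rat (c t) * z ^ t) = (0 :: complex)"
  obtains P :: "int poly" where "P \<noteq> 0" "degree P \<le> D" "poly (map_poly of_int P) z = 0"
proof -
  define R :: "rat poly" where "R = (\<Sum>t\<le>D. monom (c t) t)"
  have cR: "coeff R i = (if i \<le> D then c i else 0)" for i
    by (simp add: R_def coeff_sum sum.delta')
  obtain d P where dP: "rat_to_normalized_int_poly R = (d, P)" by force
  note P = rat_to_normalized_int_poly[OF dP]
  have R: "R \<noteq> 0" using assms(1) cR by (metis coeff_0)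
  have dR: "degree R \<le> D" by (intro degree_le) (simp add: cR)
  have "0 = (\<Sum>t\<le>D. of_rat (c t) * z ^ t)" using assms(2) by simp
  also have "\<dots> = (\<Sum>t\<le>D. of_rat d * (of_int (coeff P t) * z ^ t))"
  proof (rule sum.cong)
    fix t assume "t \<in> {..D}"
    then have "c t = d * of_int (coeff P t)" using cR[of t] P(1) by (simp add: coeff_map_poly)
    then show "of_rat (c t) * z ^ t = of_rat d * (of_int (coeff P t) * z ^ t)"
      by (simp add: of_rat_mult)
  qed simp
  also have "\<dots> = of_rat d * (\<Sum>t\<le>D. of_int (coeff P t) * z ^ t)" by (simp add: sum_distrib_left)
  also have "(\<Sum>t\<le>D. of_int (coeff P t) * z ^ t) = (\<Sum>t\<le>degree P. of_int (coeff P t) * z ^ t)"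
    using dR P(4) by (intro sum.mono_neutral_right) (auto simp: coeff_eq_0)
  also have "\<dots> = poly (map_poly of_int P) z"
    by (simp add: poly_altdef coeff_map_poly degree_map_poly)
  finally have "poly (map_poly of_int P) z = 0" using P(2) by simp
  moreover have "P \<noteq> 0" using R P(1) by auto
  ultimately show ?thesis using that dR P(4) by auto
qed

text \<open>The \<open>n\<^sup>2 + 1\<close> numbers \<open>x\<^sup>t y\<^bsup>D-t\<^esup>\<close>, \<open>D = n\<^sup>2\<close>, lie in the rational span of the \<open>n\<^sup>2\<close> numbers
  \<open>x\<^sup>i y\<^sup>j\<close> with \<open>i, j < n\<close>.\<close>

lemma root_quotient_annihilator:
  fixes f :: "int poly" and x y :: complex
  assumes f: "0 < degree f" and x: "poly (map_poly of_int f) x = 0"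
    and y: "poly (map_poly of_int f) y = 0" "y \<noteq> 0"
  obtains P :: "int poly" where "P \<noteq> 0" "degree P \<le> degree f ^ 2" "poly (map_poly of_int P) (x / y) = 0"
proof -
  \<comment> \<open>The complex numbers as a vector space over the rationals.\<close>
  interpret V: vector_space "\<lambda>(q :: rat) (z :: complex). of_rat q * z"
    by unfold_locales (auto simp: algebra_simps of_rat_add of_rat_mult)
  define n D where "n = degree f" and "D = degree f ^ 2"
  define F where "F = (map_poly of_int f :: rat poly)"
  have dF: "degree F = n" by (simp add: F_def n_def degree_map_poly)
  have "map_poly of_rat F = (map_poly of_int f :: complex poly)"
    unfolding F_def by (subst map_poly_map_poly) (auto simp: o_def)
  then have root: "poly (map_poly of_rat F) x = 0" "poly (map_poly of_rat F) y = 0"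
    using x y by auto
  have n0: "0 < degree F" using f dF n_def by simp
  define S where "S = (\<lambda>(i, j). x ^ i * y ^ j) ` ({..<n} \<times> {..<n})"
  have finS: "finite S" unfolding S_def by simp
  have "card S \<le> card ({..<n} \<times> {..<n})" unfolding S_def by (rule card_image_le) simp
  then have cardS: "card S \<le> D" by (simp add: D_def n_def power2_eq_square)
  have span: "x ^ s * y ^ t \<in> V.span S" for s t
  proof -
    obtain c where c: "x ^ s = (\<Sum>i<degree F. of_rat (c i) * x ^ i)"
      using power_eq_poly_less_degree[OF root(1) n0] by blast
    obtain d where d: "y ^ t = (\<Sum>i<degree F. of_rat (d i) * y ^ i)"
      using power_eq_poly_less_degree[OF root(2) n0] by blast
    have "x ^ s * y ^ t = (\<Sum>i<n. \<Sum>j<n. of_rat (c i * d j) * (x ^ i * y ^ j))"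
      unfolding c d dF sum_product by (intro sum.cong) (simp_all add: of_rat_mult)
    also have "\<dots> \<in> V.span S"
      by (intro V.span_sum V.span_scale V.span_base) (auto simp: S_def)
    finally show ?thesis .
  qed
  define v where "v = (\<lambda>t. x ^ t * y ^ (D - t))"
  have v: "v t = y ^ D * (x / y) ^ t" if "t \<le> D" for t
    using that y(2) by (simp add: v_def power_divide power_diff)
  have "\<exists>c :: nat \<Rightarrow> rat. (\<exists>t\<le>D. c t \<noteq> 0) \<and> (\<Sum>t\<le>D. of_rat (c t) * v t) = 0"
  \<comment> \<open>\<open>V.dependent\<close> speaks of a set of vectors, so it applies only if the
    \<open>v t\<close> are distinct. Otherwise two equal ones give a relation by
    subtraction.\<close>
  proof (cases "inj_on v {..D}")
    case True
    have "V.dependent (v ` {..D})"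
    proof (rule ccontr)
      assume "\<not> V.dependent (v ` {..D})"
      then have "card (v ` {..D}) \<le> card S"
        using V.independent_span_bound[OF finS, of "v ` {..D}"] span by (auto simp: v_def)
      then show False using cardS by (simp add: card_image[OF True])
    qed
    then obtain u w where u: "w \<in> v ` {..D}" "u w \<noteq> 0" "(\<Sum>w\<in>v ` {..D}. of_rat (u w) * w) = 0"
      using V.dependent_finite[of "v ` {..D}"] by auto
    then have "(\<Sum>t\<le>D. of_rat (u (v t)) * v t) = 0" by (simp add: sum.reindex[OF True])
    with u show ?thesis by (intro exI[of _ "\<lambda>t. u (v t)"]) auto
  next
    case False
    then obtain s t where st: "s \<le> D" "t \<le> D" "s \<noteq> t" "v s = v t" by (auto simp: inj_on_def)
    let ?c = "\<lambda>i. (if i = s then 1 else 0) - (if i = t then 1 else 0) :: rat"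
    have "(\<Sum>i\<le>D. of_rat (?c i) * v i)
            = (\<Sum>i\<le>D. (if i = s then v i else 0)) - (\<Sum>i\<le>D. (if i = t then v i else 0))"
      unfolding sum_subtractf[symmetric] by (intro sum.cong) auto
    also have "\<dots> = 0" using st by (simp add: sum.delta')
    finally show ?thesis using st by (intro exI[of _ ?c]) auto
  qed
  then obtain c :: "nat \<Rightarrow> rat" where c: "\<exists>t\<le>D. c t \<noteq> 0" "(\<Sum>t\<le>D. of_rat (c t) * v t) = 0"
    by blast
  \<comment> \<open>The monomials are homogeneous of degree \<open>D\<close>, so dividing by
    \<open>y ^ D\<close> leaves a relation in the powers of \<open>x / y\<close>.\<close>
  have "(\<Sum>t\<le>D. of_rat (c t) * v t) = y ^ D * (\<Sum>t\<le>D. of_rat (c t) * (x / y) ^ t)"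
    unfolding sum_distrib_left by (intro sum.cong) (auto simp: v)
  then have "(\<Sum>t\<le>D. of_rat (c t) * (x / y) ^ t) = 0" using c y(2) by simp
  from rat_dependence_imp_int_poly[OF c(1) this] show ?thesis using that unfolding D_def by blast
qed

text \<open>The polynomial is monic and all its roots have absolute value 1.\<close>

lemma mahler_measure_X_pow_minus_1:
  assumes k: "0 < k"
  shows "mahler_measure (monom 1 k - 1) = 1"
proof -
  let ?p = "map_poly of_int (monom 1 k - 1) :: complex poly"
  have p: "?p = monom 1 k - 1"
    by (simp add: of_int_poly_hom.hom_minus map_poly_monom)
  have lc: "lead_coeff ?p = 1" and p0: "?p \<noteq> 0"
  proof -
    have "degree (monom 1 k - 1 :: complex poly) = k"
      using k by (intro antisym degree_le le_degree) (auto simp: coeff_1)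
    then show "lead_coeff ?p = 1" using k by (simp add: p coeff_1)
    then show "?p \<noteq> 0" by force
  qed
  have "cmod a = 1" if "a \<in> set (complex_roots_complex ?p)" for a
  proof -
    have "poly (\<Prod>a\<leftarrow>complex_roots_complex ?p. [:- a, 1:]) a = 0"
      using that by (auto simp: poly_prod_list prod_list_zero_iff)
    then have "poly ?p a = 0" using complex_roots(1)[of ?p] by (metis mult_zero_right poly_smult)
    then have "a ^ k = 1" by (simp add: p poly_monom)
    then have "cmod a ^ k = 1" by (metis norm_one norm_power)
    then show ?thesis using power_eq_imp_eq_base[of "cmod a" k 1] k by simp
  qed
  then have "map (\<lambda>a. max 1 (cmod a)) (complex_roots_complex ?p)
               = map (\<lambda>a. 1) (complex_roots_complex ?p)" by (intro map_cong) auto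
  then show ?thesis
    by (simp only: mahler_measure_def mahler_measure_poly_def lc map_replicate_const prod_list_replicate) simp
qed

text \<open>\<open>2 ^ D\<close> is the coefficient bound for an integer polynomial of degree at
  most \<open>D\<close> and Mahler measure at most 1. The set is finite and is meant to contain all
  relevant roots of unity; it contains other numbers too.\<close>

definition small_numbers :: "nat \<Rightarrow> complex set" where
  "small_numbers D = {z. \<exists>G\<in>coeff_box D (2 ^ D). G \<noteq> 0 \<and> poly (map_poly of_int G) z = 0}"

lemma finite_small_numbers: "finite (small_numbers D)"
proof -
  have "small_numbers D = (\<Union>G\<in>coeff_box D (2 ^ D) - {0}. {z. poly (map_poly of_int G) z = 0})"
    by (auto simp: small_numbers_def)
  then show ?thesis using finite_coeff_box by (auto intro!: poly_roots_finite)
qed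

text \<open>The gcd of \<open>P\<close> and \<open>X\<^sup>k - 1\<close> has Mahler measure at most 1.\<close>

lemma root_of_unity_in_small_numbers:
  assumes P: "P \<noteq> 0" "degree P \<le> D" "poly (map_poly of_int P) z = 0"
    and z: "z ^ k = 1" "0 < k"
  shows "z \<in> small_numbers D"
proof -
  interpret of_rat_hom: field_char_0_hom "of_rat :: rat \<Rightarrow> complex" ..
  interpret h: map_poly_comm_ring_hom "of_rat :: rat \<Rightarrow> complex" ..
  let ?c = "\<lambda>f. map_poly of_int f :: complex poly" and ?q = "\<lambda>f. map_poly of_int f :: rat poly"
  have cq: "map_poly of_rat (?q f) = ?c f" for f
    by (subst map_poly_map_poly) (auto simp: o_def)
  define E :: "int poly" where "E = monom 1 k - 1"
  define G where "G = gcd P E"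
  have G0: "G \<noteq> 0" using P by (simp add: G_def)
  have E: "poly (?c E) z = 0"
    using z by (simp add: E_def of_int_poly_hom.hom_minus map_poly_monom poly_monom)
  \<comment> \<open>Bezout's identity is taken over the rationals, where the gcd is a nonzero scalar
    multiple of \<open>G\<close>. It shows that the common root \<open>z\<close> of \<open>P\<close>
    and \<open>E\<close> is a root of \<open>G\<close>.\<close>
  obtain a b where "a * ?q P + b * ?q E = gcd (?q P) (?q E)"
    using bezout_coefficients_fst_snd by blast
  then have "a * ?q P + b * ?q E = smult (inverse (of_int (lead_coeff G))) (?q G)"
    by (simp add: gcd_rat_to_gcd_int G_def)
  then have "(map_poly of_rat (a * ?q P + b * ?q E) :: complex poly)
      = map_poly of_rat (smult (inverse (of_int (lead_coeff G))) (?q G))" by simp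
  then have "map_poly of_rat a * ?c P + map_poly of_rat b * ?c E
      = smult (of_rat (inverse (of_int (lead_coeff G)))) (?c G)"
    by (simp add: h.hom_add h.hom_mult cq of_rat_hom.map_poly_hom_smult)
  then have "poly (smult (of_rat (inverse (of_int (lead_coeff G)))) (?c G)) z = 0"
    using P E by (metis add.right_neutral mult_zero_right poly_add poly_mult)
  then have Gz: "poly (?c G) z = 0" using G0 by simp
  obtain Q where Q: "E = G * Q" unfolding G_def by (metis gcd_dvd2 dvdE)
  have E1: "mahler_measure E = 1" unfolding E_def by (rule mahler_measure_X_pow_minus_1[OF z(2)])
  have "Q \<noteq> 0" using E1 Q by (auto simp: mahler_measure_def)
  \<comment> \<open>The nonzero integer polynomial \<open>Q\<close> has Mahler measure at least 1,
    so \<open>G\<close> cannot exceed the measure 1 of the product \<open>E\<close>.\<close>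
  then have "mahler_measure G * 1 \<le> mahler_measure G * mahler_measure Q"
    by (intro mult_left_mono mahler_measure_poly_ge_1 mahler_measure_ge_0)
  then have MG: "mahler_measure G \<le> 1" using E1 by (simp add: Q mahler_measure_mult)
  have dG: "degree G \<le> D" using P dvd_imp_degree_le[of G P] by (simp add: G_def)
  have "real (naive_height G) \<le> 2 ^ degree G * mahler_measure G"
    by (rule naive_height_le_mahler_measure)
  also have "\<dots> \<le> 2 ^ D * 1"
    using dG MG by (intro mult_mono power_increasing mahler_measure_ge_0) auto
  finally have "naive_height G \<le> 2 ^ D" by (simp flip: of_nat_le_iff)
  then have "\<bar>coeff G j\<bar> \<le> int (2 ^ D)" for j
    using abs_coeff_le_naive_height[of G j] by linarith
  then have "G \<in> coeff_box D (2 ^ D)" using dG by (simp add: coeff_box_def)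
  then show ?thesis using G0 Gz by (auto simp: small_numbers_def)
qed

section \<open>Upper bound in degree at least three\<close>

lemma degree_eq_if_degenerate_polys: "f \<in> degenerate_polys n H \<Longrightarrow> degree f = n"
  by (auto simp: degenerate_polys_def intro: antisym le_degree)

lemma naive_height_le_if_degenerate_polys: "f \<in> degenerate_polys n H \<Longrightarrow> naive_height f \<le> H"
  using naive_height_attained[of f] degree_eq_if_degenerate_polys[of f n H]
  by (force simp: degenerate_polys_def)

lemma two_roots_imp_degree_ge_2:
  fixes f :: "int poly" and x y :: complex
  assumes "f \<noteq> 0" "poly (map_poly of_int f) x = 0" "poly (map_poly of_int f) y = 0" "x \<noteq> y"
  shows "2 \<le> degree f"
proof -
  let ?f = "map_poly of_int f :: complex poly"
  have f: "?f \<noteq> 0" using assms by simp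
  have "card {x, y} \<le> card {x. poly ?f x = 0}"
    using assms by (intro card_mono poly_roots_finite[OF f]) auto
  then show ?thesis using card_poly_roots_bound[OF f] assms(4) by (simp add: degree_map_poly)
qed

text \<open>If both roots of the degenerate pair belong to one factor, that factor serves as
  \<open>q\<close>. If they are split, the factor of larger degree does; its degree is at least 2
  because \<open>n\<close> is at least 3.\<close>

lemma degenerate_polys_factorization:
  assumes f: "f \<in> degenerate_polys n H" "reducible_over_rat f" and n: "3 \<le> n"
  obtains p q z where "f = p * q" "1 \<le> degree p" "2 \<le> degree q" "degree p + degree q = n"
    "z \<in> small_numbers (n ^ 2) - {1}"
    "\<exists>x. (poly (map_poly of_int q) x = 0 \<or> poly (map_poly of_int p) x = 0)
           \<and> poly (map_poly of_int q) (z * x) = 0"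
proof -
  note result = that
  let ?c = "\<lambda>f. map_poly of_int f :: complex poly"
  have deg: "degree f = n" using f degree_eq_if_degenerate_polys by blast
  obtain x y k where xy: "poly (?c f) x = 0" "poly (?c f) y = 0" "x \<noteq> y" "0 < k" "(x / y) ^ k = 1"
    using f by (auto simp: degenerate_polys_def degenerate_def)
  have x0: "x \<noteq> 0" and y0: "y \<noteq> 0" using xy(4,5) by (auto simp: power_0_left)
  have yx: "(y / x) ^ k = 1" using xy(5) x0 y0 by (simp add: power_divide)
  \<comment> \<open>Both orders of the quotient are covered, because choosing which factor is
    \<open>q\<close> may exchange \<open>x\<close> and \<open>y\<close>.\<close>
  have mem: "u / v \<in> small_numbers (n ^ 2) - {1}" if uv: "(u, v) \<in> {(x, y), (y, x)}" for u v
  proof -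
    have f0: "0 < degree f" using deg n by simp
    have "poly (?c f) u = 0" "poly (?c f) v = 0" "v \<noteq> 0" using uv xy x0 y0 by auto
    from root_quotient_annihilator[OF f0 this] obtain P :: "int poly"
      where "P \<noteq> 0" "degree P \<le> n ^ 2" "poly (?c P) (u / v) = 0" unfolding deg by blast
    moreover have "(u / v) ^ k = 1" using uv xy yx by auto
    ultimately have "u / v \<in> small_numbers (n ^ 2)"
      using xy(4) root_of_unity_in_small_numbers by blast
    then show ?thesis using uv xy(3) x0 y0 by auto
  qed
  \<comment> \<open>Here \<open>v\<close> is the root that surely belongs to \<open>q\<close>, and
    the twist is \<open>z = v / u\<close>, which maps \<open>u\<close> to \<open>v\<close>.\<close>
  have step: thesis
    if pq: "f = p * q" "0 < degree p" "0 < degree q" and uv: "(u, v) \<in> {(x, y), (y, x)}"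
      and v: "poly (?c q) v = 0" and u: "poly (?c q) u = 0 \<or> poly (?c p) u = 0 \<and> degree p \<le> degree q"
    for p q u v
  proof -
    have sum: "degree p + degree q = n" using pq deg by (metis degree_0 degree_mult_eq less_numeral_extra(3))
    have "2 \<le> degree q"
    proof (cases "poly (?c q) u = 0")
      case True
      moreover have "q \<noteq> 0" "u \<noteq> v" using pq uv xy(3) by auto
      ultimately show ?thesis using v two_roots_imp_degree_ge_2 by blast
    qed (use u sum n in auto)
    moreover have vu: "v / u \<in> small_numbers (n ^ 2) - {1}" "v / u * u = v"
      using mem[of v u] uv x0 y0 by auto
    ultimately show thesis
      using result[OF pq(1) _ _ sum vu(1)] pq(2) u v vu(2) by (metis One_nat_def Suc_leI)
  qed
  obtain a b where ab: "f = a * b" "0 < degree a" "0 < degree b"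
    using reducible_over_rat_factor[OF f(2)] by blast
  then have ba: "f = b * a" by simp
  have "poly (?c a) w = 0 \<or> poly (?c b) w = 0" if "poly (?c f) w = 0" for w
    using that by (simp add: ab(1) of_int_poly_hom.hom_mult)
  then consider "poly (?c a) x = 0" "poly (?c a) y = 0" | "poly (?c b) x = 0" "poly (?c b) y = 0"
    | "poly (?c a) x = 0" "poly (?c b) y = 0" | "poly (?c b) x = 0" "poly (?c a) y = 0"
    using xy by blast
  then show thesis
  proof cases
    case 1 then show thesis using step[OF ba ab(3,2), of x y] by auto
  next
    case 2 then show thesis using step[OF ab, of x y] by auto
  next
    case 3 then show thesis
      using step[OF ab, of x y] step[OF ba ab(3,2), of y x] by (cases "degree a \<le> degree b") auto
  next
    case 4 then show thesis
      using step[OF ab, of y x] step[OF ba ab(3,2), of x y] by (cases "degree a \<le> degree b") auto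
  qed
qed

section \<open>Counting the factorizations\<close>

text \<open>The candidates for the second factor once \<open>p\<close> is fixed. For
  \<open>z = 1\<close> the first alternative would only say that \<open>q\<close> has a root, hence
  the removal of \<open>1\<close>.\<close>

definition partners :: "complex set \<Rightarrow> int poly \<Rightarrow> nat \<Rightarrow> nat \<Rightarrow> int poly set" where
  "partners Z p b N = {q \<in> coeff_box b N. \<exists>z\<in>Z - {1}.
     \<exists>x. (poly (map_poly of_int q) x = 0 \<or> poly (map_poly of_int p) x = 0)
           \<and> poly (map_poly of_int q) (z * x) = 0}"

lemma finite_partners: "finite (partners Z p b N)"
  unfolding partners_def using finite_coeff_box by (rule finite_subset[rotated]) auto

text \<open>Fix \<open>z\<close>. If \<open>x\<close> is a root of \<open>q\<close>, the
  twisted-root count gives the factor \<open>n + 1\<close>. If \<open>x\<close> is a root of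
  \<open>p\<close>, then \<open>z * x\<close> is one of at most \<open>n\<close> prescribed roots of
  \<open>q\<close>. Together this is \<open>2 * n + 1\<close>.\<close>

lemma card_partners_le:
  assumes Z: "finite Z" and p: "p \<noteq> 0" "degree p \<le> n" and b: "1 \<le> b" "b \<le> n"
  shows "card (partners Z p b N) \<le> card Z * (2 * n + 1) * (2 * N + 1) ^ b"
proof -
  let ?c = "\<lambda>f. map_poly of_int f :: complex poly" and ?X = "(2 * N + 1) ^ b"
  let ?R = "{x. poly (?c p) x = 0}"
  have finR: "finite ?R" using p by (intro poly_roots_finite) simp
  have cardR: "card ?R \<le> n"
    using card_poly_roots_bound[of "?c p"] p by (simp add: degree_map_poly)
  define A where "A = (\<lambda>z. {q \<in> coeff_box b N. \<exists>x. poly (?c q) x = 0 \<and> poly (?c q) (z * x) = 0})"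
  define B where "B = (\<lambda>w. {q \<in> coeff_box b N. poly (?c q) w = 0})"
  have fin: "finite (A z)" "finite (B w)" for z w
    unfolding A_def B_def using finite_coeff_box by (auto intro: finite_subset)
  have "card (partners Z p b N) \<le> card (\<Union>z\<in>Z - {1}. A z \<union> (\<Union>x\<in>?R. B (z * x)))"
    using Z finR fin by (intro card_mono) (auto simp: partners_def A_def B_def)
  also have "\<dots> \<le> (\<Sum>z\<in>Z - {1}. card (A z \<union> (\<Union>x\<in>?R. B (z * x))))"
    using Z by (intro card_UN_le) auto
  also have "\<dots> \<le> (\<Sum>z\<in>Z - {1}. (2 * n + 1) * ?X)"
  proof (rule sum_mono)
    fix z assume z: "z \<in> Z - {1}"
    have "card (\<Union>x\<in>?R. B (z * x)) \<le> (\<Sum>x\<in>?R. card (B (z * x)))"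
      by (rule card_UN_le[OF finR])
    also have "\<dots> \<le> (\<Sum>x\<in>?R. ?X)"
      unfolding B_def by (intro sum_mono card_coeff_box_root_le)
    also have "\<dots> \<le> n * ?X" using cardR by simp
    finally have B: "card (\<Union>x\<in>?R. B (z * x)) \<le> n * ?X" .
    have "card (A z) \<le> (b + 1) * ?X"
      unfolding A_def using z b by (intro card_coeff_box_twisted_root_le) auto
    also have "\<dots> \<le> (n + 1) * ?X" using b by (intro mult_right_mono) auto
    finally have "card (A z \<union> (\<Union>x\<in>?R. B (z * x))) \<le> (n + 1) * ?X + n * ?X"
      using B card_Un_le[of "A z" "\<Union>x\<in>?R. B (z * x)"] by linarith
    then show "card (A z \<union> (\<Union>x\<in>?R. B (z * x))) \<le> (2 * n + 1) * ?X"
      by (simp add: algebra_simps)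
  qed
  also have "\<dots> = card (Z - {1}) * (2 * n + 1) * ?X" by (simp only: sum_constant mult.assoc of_nat_id)
  also have "\<dots> \<le> card Z * (2 * n + 1) * ?X"
    using Z by (intro mult_right_mono card_mono) auto
  finally show ?thesis .
qed

text \<open>Factorizations \<open>p * q\<close> are sorted by degree \<open>a\<close> and height
  \<open>M\<close> of \<open>p\<close>; the bound on the product of heights then confines
  \<open>q\<close> to height \<open>T div M\<close>. The constant is obtained before
  \<open>H\<close> and so is uniform in it.\<close>

lemma R_star_le_sum:
  assumes n: "3 \<le> n"
  obtains K :: nat where
    "\<And>H. R_star n H \<le> K * (\<Sum>a=1..n - 2. \<Sum>M=1..2 ^ n * (n + 1) * H.
       M ^ a * (2 ^ n * (n + 1) * H div M) ^ (n - a))"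
proof -
  define Z where "Z = small_numbers (n ^ 2)"
  have finZ: "finite Z" unfolding Z_def by (rule finite_small_numbers)
  \<comment> \<open>The factors come from counting \<open>p\<close> of a given height, from counting
    partners, and from \<open>2 * M + 1 \<le> 3 * M\<close> together with the same estimate for
    \<open>T div M\<close>, both numbers being at least 1.\<close>
  define K where "K = 2 * (n + 1) * (card Z * (2 * n + 1)) * 3 ^ n"
  have "R_star n H \<le> K * (\<Sum>a=1..n - 2. \<Sum>M=1..T. M ^ a * (T div M) ^ (n - a))"
    if T: "T = 2 ^ n * (n + 1) * H" for H T
  proof -
    define P where "P = (\<lambda>a M. {p :: int poly. degree p = a \<and> naive_height p = M})"
    define E where "E = (\<lambda>a M p. partners Z p (n - a) (T div M))"
    have finP: "finite (P a M)" for a M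
      unfolding P_def using abs_coeff_le_naive_height
      by (intro finite_subset[OF _ finite_coeff_box[of a M]]) (auto simp: coeff_box_def)
    have finE: "finite (E a M p)" for a M p unfolding E_def by (rule finite_partners)
    let ?U = "\<Union>a\<in>{1..n - 2}. \<Union>M\<in>{1..T}. \<Union>p\<in>P a M. (\<lambda>q. p * q) ` E a M p"
    have sub: "{f \<in> degenerate_polys n H. reducible_over_rat f} \<subseteq> ?U"
    proof
      fix f assume "f \<in> {f \<in> degenerate_polys n H. reducible_over_rat f}"
      then have f: "f \<in> degenerate_polys n H" "reducible_over_rat f" by auto
      obtain p q z where pq: "f = p * q" "1 \<le> degree p" "2 \<le> degree q" "degree p + degree q = n"
        "z \<in> Z - {1}" "\<exists>x. (poly (map_poly of_int q) x = 0 \<or> poly (map_poly of_int p) x = 0)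
           \<and> poly (map_poly of_int q) (z * x) = (0 :: complex)"
        using degenerate_polys_factorization[OF f n] unfolding Z_def by metis
      define M where "M = naive_height p"
      have nz: "p \<noteq> 0" "q \<noteq> 0" using pq by auto
      have M1: "1 \<le> M" using naive_height_pos[OF nz(1)] by (simp add: M_def)
      have "M * naive_height q \<le> 2 ^ n * (n + 1) * naive_height f"
        using naive_height_mult_le[of p q n] pq by (simp add: M_def)
      also have "\<dots> \<le> T"
        unfolding T using naive_height_le_if_degenerate_polys[OF f(1)] by simp
      finally have MT: "M * naive_height q \<le> T" .
      have "M * 1 \<le> M * naive_height q" using naive_height_pos[OF nz(2)] by (intro mult_le_mono2) simp
      then have "M \<le> T" using MT by linarith
      have hq: "naive_height q \<le> T div M"
        using MT M1 by (simp add: less_eq_div_iff_mult_less_eq mult.commute)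
      have "\<bar>coeff q j\<bar> \<le> int (T div M)" for j
        using abs_coeff_le_naive_height[of q j] hq by linarith
      then have "q \<in> E (degree p) M p"
        using pq by (auto simp: E_def partners_def coeff_box_def)
      then have im: "f \<in> (\<lambda>q. p * q) ` E (degree p) M p" using pq(1) by blast
      have a: "degree p \<in> {1..n - 2}" using pq by auto
      have p: "p \<in> P (degree p) M" by (simp add: P_def M_def)
      from M1 \<open>M \<le> T\<close> have M: "M \<in> {1..T}" by simp
      show "f \<in> ?U" by (rule UN_I[OF a], rule UN_I[OF M], rule UN_I[OF p], rule im)
    qed
    have "R_star n H \<le> card ?U"
      unfolding R_star_def using finP finE by (intro card_mono[OF _ sub]) auto
    also have "\<dots> \<le> (\<Sum>a=1..n - 2. card (\<Union>M\<in>{1..T}. \<Union>p\<in>P a M. (\<lambda>q. p * q) ` E a M p))"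
      by (rule card_UN_le) simp
    also have "\<dots> \<le> (\<Sum>a=1..n - 2. \<Sum>M=1..T. card (\<Union>p\<in>P a M. (\<lambda>q. p * q) ` E a M p))"
      by (intro sum_mono card_UN_le) simp
    also have "\<dots> \<le> (\<Sum>a=1..n - 2. \<Sum>M=1..T. K * (M ^ a * (T div M) ^ (n - a)))"
    proof (intro sum_mono)
      fix a M assume a: "a \<in> {1..n - 2}" and M: "M \<in> {1..T}"
      let ?D = "card Z * (2 * n + 1)"
      have N1: "1 \<le> T div M" using M by (simp add: Suc_le_eq div_greater_zero_iff)
      have "card (\<Union>p\<in>P a M. (\<lambda>q. p * q) ` E a M p) \<le> (\<Sum>p\<in>P a M. card ((\<lambda>q. p * q) ` E a M p))"
        by (rule card_UN_le[OF finP])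
      also have "\<dots> \<le> (\<Sum>p\<in>P a M. ?D * (2 * (T div M) + 1) ^ (n - a))"
      proof (rule sum_mono)
        fix p assume p: "p \<in> P a M"
        have "card ((\<lambda>q. p * q) ` E a M p) \<le> card (E a M p)" by (rule card_image_le[OF finE])
        also have "\<dots> \<le> ?D * (2 * (T div M) + 1) ^ (n - a)"
          unfolding E_def using p a n by (intro card_partners_le finZ) (auto simp: P_def)
        finally show "card ((\<lambda>q. p * q) ` E a M p) \<le> ?D * (2 * (T div M) + 1) ^ (n - a)" .
      qed
      also have "\<dots> = card (P a M) * (?D * (2 * (T div M) + 1) ^ (n - a))" by simp
      also have "\<dots> \<le> (2 * (a + 1) * (2 * M + 1) ^ a) * (?D * (2 * (T div M) + 1) ^ (n - a))"
        unfolding P_def by (intro mult_right_mono card_naive_height_eq_le) simp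
      also have "\<dots> \<le> (2 * (n + 1) * (3 * M) ^ a) * (?D * (3 * (T div M)) ^ (n - a))"
        using M N1 a by (intro mult_mono power_mono) auto
      also have "\<dots> = 2 * (n + 1) * ?D * (3 ^ a * 3 ^ (n - a)) * (M ^ a * (T div M) ^ (n - a))"
        by (simp only: power_mult_distrib mult_ac)
      also have "3 ^ a * 3 ^ (n - a) = (3 ^ n :: nat)"
      proof -
        have "a + (n - a) = n" using a by auto
        then show ?thesis by (simp flip: power_add)
      qed
      finally show "card (\<Union>p\<in>P a M. (\<lambda>q. p * q) ` E a M p) \<le> K * (M ^ a * (T div M) ^ (n - a))"
        by (simp add: K_def)
    qed
    finally show ?thesis by (simp add: sum_distrib_left)
  qed
  then show ?thesis using that by blast
qed

section \<open>Estimates for the sums over heights\<close>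

lemma sum_inverse_squares_le: "(\<Sum>M=1..T. 1 / real M ^ 2) \<le> 2"
proof -
  \<comment> \<open>Strengthened so that the induction telescopes. At \<open>T = 0\<close> the term
    \<open>1 / real T\<close> is 0 by convention, so the step from 0 to 1 is treated apart.\<close>
  have "(\<Sum>M=1..T. 1 / real M ^ 2) \<le> 2 - 1 / real T"
  proof (induction T)
    case (Suc T)
    show ?case
    proof (cases "T = 0")
      case False
      then have "1 / real (Suc T) ^ 2 \<le> 1 / real T - 1 / real (Suc T)"
      proof -
        have "1 / real T - 1 / real (Suc T) = 1 / (real T * real (Suc T))"
          using False by (simp add: field_simps)
        moreover have "1 / real (Suc T) ^ 2 \<le> 1 / (real T * real (Suc T))"
          unfolding power2_eq_square using False by (intro divide_left_mono mult_mono) auto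
        ultimately show ?thesis by simp
      qed
      with Suc show ?thesis by simp
    qed simp
  qed simp
  moreover have "0 \<le> 1 / real T" by simp
  ultimately show ?thesis by linarith
qed

text \<open>\<open>harm T - ln T\<close> decreases in \<open>T\<close> and equals 1 at
  \<open>T = 1\<close>.\<close>

lemma harm_le: "1 \<le> T \<Longrightarrow> harm T \<le> 1 + ln (real T)"
  using euler_mascheroni_sequence_decreasing[of 1 T] by (simp add: harm_expand)

lemma power_mult_div_power_le:
  fixes M T :: nat
  assumes "a \<le> m" "b \<le> m" "1 \<le> M" "M \<le> T"
  shows "M ^ a * (T div M) ^ b \<le> T ^ m"
proof -
  have N: "1 \<le> T div M" using assms by (simp add: Suc_le_eq div_greater_zero_iff)
  have "M ^ a * (T div M) ^ b \<le> M ^ m * (T div M) ^ m"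
    using assms N by (intro mult_mono power_increasing) auto
  also have "\<dots> = (M * (T div M)) ^ m" by (simp add: power_mult_distrib)
  also have "\<dots> \<le> T ^ m" by (intro power_mono) auto
  finally show ?thesis .
qed

text \<open>For \<open>a = 1\<close> the summands are at most
  \<open>T ^ (n - 1) / M ^ (n - 2)\<close>, and \<open>n - 2 \<ge> 2\<close> makes the series
  converge. For other \<open>a\<close> both exponents are at most \<open>n - 2\<close>, so each of
  the \<open>T\<close> summands is at most \<open>T ^ (n - 2)\<close>.\<close>

lemma sum_hyperbola_le:
  fixes T n :: nat
  assumes n: "4 \<le> n"
  shows "(\<Sum>a=1..n - 2. \<Sum>M=1..T. M ^ a * (T div M) ^ (n - a)) \<le> 2 * n * T ^ (n - 1)"
proof -
  have "(\<Sum>M=1..T. M ^ a * (T div M) ^ (n - a)) \<le> 2 * T ^ (n - 1)" if a: "a \<in> {1..n - 2}" for a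
  proof (cases "a = 1")
    case True
    have "real (\<Sum>M=1..T. M ^ a * (T div M) ^ (n - a)) \<le> (\<Sum>M=1..T. real T ^ (n - 1) * (1 / real M ^ 2))"
      unfolding of_nat_sum
    proof (rule sum_mono)
      fix M assume M: "M \<in> {1..T}"
      have "real (M ^ a * (T div M) ^ (n - a)) \<le> real M * (real T / real M) ^ (n - 1)"
        using True by (simp add: mult_left_mono power_mono of_nat_div_le_of_nat)
      also have "\<dots> = real T ^ (n - 1) * (1 / real M ^ (n - 2))"
      proof -
        define m where "m = n - 2"
        then have "n = m + 2" using n by simp
        then show ?thesis using M by (simp add: power_divide)
      qed
      also have "\<dots> \<le> real T ^ (n - 1) * (1 / real M ^ 2)"
        using M n by (intro mult_left_mono divide_left_mono power_increasing) auto
      finally show "real (M ^ a * (T div M) ^ (n - a)) \<le> real T ^ (n - 1) * (1 / real M ^ 2)" .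
    qed
    also have "\<dots> = real T ^ (n - 1) * (\<Sum>M=1..T. 1 / real M ^ 2)" by (simp only: sum_distrib_left)
    also have "\<dots> \<le> real T ^ (n - 1) * 2" by (intro mult_left_mono sum_inverse_squares_le) simp
    also have "\<dots> = real (2 * T ^ (n - 1))" by simp
    finally show ?thesis by (simp only: of_nat_le_iff)
  next
    case False
    have "(\<Sum>M=1..T. M ^ a * (T div M) ^ (n - a)) \<le> (\<Sum>M=1..T. T ^ (n - 2))"
      using a False by (intro sum_mono power_mult_div_power_le) auto
    also have "\<dots> = T ^ Suc (n - 2)" by simp
    also have "Suc (n - 2) = n - 1" using n by simp
    finally show ?thesis by simp
  qed
  then have "(\<Sum>a=1..n - 2. \<Sum>M=1..T. M ^ a * (T div M) ^ (n - a)) \<le> (\<Sum>a=1..n - 2. 2 * T ^ (n - 1))"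
    by (rule sum_mono)
  also have "\<dots> \<le> 2 * n * T ^ (n - 1)" by simp
  finally show ?thesis .
qed

lemma sum_hyperbola_3_le:
  "real (\<Sum>M=1..T. M * (T div M) ^ 2) \<le> real T ^ 2 * harm T"
proof -
  have "real (\<Sum>M=1..T. M * (T div M) ^ 2) \<le> (\<Sum>M=1..T. real T ^ 2 * inverse (real M))"
    unfolding of_nat_sum
  proof (rule sum_mono)
    fix M assume M: "M \<in> {1..T}"
    have "real (M * (T div M) ^ 2) \<le> real M * (real T / real M) ^ 2"
      by (simp add: mult_left_mono power_mono of_nat_div_le_of_nat)
    also have "\<dots> = real T ^ 2 * inverse (real M)"
      using M by (simp add: field_simps power2_eq_square)
    finally show "real (M * (T div M) ^ 2) \<le> real T ^ 2 * inverse (real M)" .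
  qed
  also have "\<dots> = real T ^ 2 * harm T" by (simp add: harm_def sum_distrib_left)
  finally show ?thesis .
qed

lemma R_star_upper_ge_4:
  assumes n: "4 \<le> n"
  shows "\<exists>C>0. \<forall>H. real (R_star n H) \<le> C * real H ^ (n - 1)"
proof -
  define c where "c = 2 ^ n * (n + 1)"
  obtain K where K: "\<And>H. R_star n H \<le> K * (\<Sum>a=1..n - 2. \<Sum>M=1..c * H. M ^ a * (c * H div M) ^ (n - a))"
    using R_star_le_sum[of n] n unfolding c_def by auto
  \<comment> \<open>The summand 1 keeps the constant positive even for \<open>K = 0\<close>.\<close>
  have "real (R_star n H) \<le> (real (K * (2 * n * c ^ (n - 1))) + 1) * real H ^ (n - 1)" for H
  proof -
    have "R_star n H \<le> K * (2 * n * (c * H) ^ (n - 1))"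
      by (rule order_trans[OF K mult_left_mono[OF sum_hyperbola_le[OF n]]]) simp
    also have "\<dots> = K * (2 * n * c ^ (n - 1)) * H ^ (n - 1)" by (simp add: power_mult_distrib)
    finally have "real (R_star n H) \<le> real (K * (2 * n * c ^ (n - 1)) * H ^ (n - 1))"
      by (simp only: of_nat_le_iff)
    also have "\<dots> \<le> (real (K * (2 * n * c ^ (n - 1))) + 1) * real H ^ (n - 1)"
      by (simp add: distrib_right)
    finally show ?thesis .
  qed
  moreover have "0 < real (K * (2 * n * c ^ (n - 1))) + 1" by (intro add_nonneg_pos) auto
  ultimately show ?thesis by blast
qed

lemma ln_ge_half: "2 \<le> H \<Longrightarrow> 1 / 2 \<le> ln (real H)"
  using ln2_ge_two_thirds ln_mono[of 2 "real H"] by linarith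

lemma R_star_3_upper: "\<exists>C>0. \<forall>H\<ge>2. real (R_star 3 H) \<le> C * (real H ^ 2 * ln (real H))"
proof -
  obtain K where K: "\<And>H. R_star 3 H \<le> K * (\<Sum>a=1..3 - 2. \<Sum>M=1..2 ^ 3 * (3 + 1) * H.
      M ^ a * (2 ^ 3 * (3 + 1) * H div M) ^ (3 - a))"
    using R_star_le_sum[of 3] by auto
  have "real (R_star 3 H) \<le> real (K + 1) * (32 ^ 2 * 8) * (real H ^ 2 * ln (real H))" if H: "2 \<le> H" for H
  proof -
    have "R_star 3 H \<le> K * (\<Sum>M=1..32 * H. M * (32 * H div M) ^ 2)"
      using K[of H] by simp
    then have "real (R_star 3 H) \<le> real K * real (\<Sum>M=1..32 * H. M * (32 * H div M) ^ 2)"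
      by (metis of_nat_le_iff of_nat_mult)
    also have "\<dots> \<le> real (K + 1) * (real (32 * H) ^ 2 * harm (32 * H))"
      by (intro mult_mono sum_hyperbola_3_le) (auto intro: sum_nonneg)
    finally have R: "real (R_star 3 H) \<le> real (K + 1) * (real (32 * H) ^ 2 * harm (32 * H))" .
    \<comment> \<open>\<open>32\<close> is \<open>2 ^ 3 * (3 + 1)\<close>. The bound
      \<open>1 + 5 * ln 2 + ln H\<close> is at most \<open>8 * ln H\<close>, since
      \<open>ln 2 \<le> ln H\<close> and \<open>1 \<le> 2 * ln H\<close>.\<close>
    have "harm (32 * H) \<le> 8 * ln (real H)"
    proof -
      have "ln (real (32 * H)) = ln (2 ^ 5) + ln (real H)" using H by (simp add: ln_mult)
      also have "ln (2 ^ 5 :: real) = 5 * ln 2" by (subst ln_realpow) auto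
      finally have "ln (real (32 * H)) = 5 * ln 2 + ln (real H)" .
      moreover have "ln 2 \<le> ln (real H)" using H by simp
      moreover have "harm (32 * H) \<le> 1 + ln (real (32 * H))" using H by (intro harm_le) simp
      ultimately show ?thesis using ln_ge_half[OF H] by linarith
    qed
    then have "real (K + 1) * (real (32 * H) ^ 2 * harm (32 * H))
        \<le> real (K + 1) * (real (32 * H) ^ 2 * (8 * ln (real H)))"
      by (intro mult_left_mono) auto
    also have "\<dots> = real (K + 1) * (32 ^ 2 * 8) * (real H ^ 2 * ln (real H))"
      by (simp add: power_mult_distrib)
    finally show ?thesis using R by linarith
  qed
  then show ?thesis by (intro exI[of _ "real (K + 1) * (32 ^ 2 * 8)"]) auto
qed

section \<open>Lower bounds\<close>

lemma finite_degenerate_polys: "finite (degenerate_polys n H)"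
proof (rule finite_subset[OF _ finite_coeff_box])
  show "degenerate_polys n H \<subseteq> coeff_box n H"
  proof
    fix f assume f: "f \<in> degenerate_polys n H"
    then have "\<bar>coeff f j\<bar> \<le> int H" for j
      using degree_eq_if_degenerate_polys[OF f]
      by (cases "j \<le> n") (auto simp: degenerate_polys_def coeff_eq_0)
    with f show "f \<in> coeff_box n H" by (simp add: coeff_box_def degenerate_polys_def)
  qed
qed

lemma card_le_R_star:
  assumes "inj_on \<phi> D" and "\<And>d. d \<in> D \<Longrightarrow> \<phi> d \<in> degenerate_polys n H \<and> reducible_over_rat (\<phi> d)"
  shows "card D \<le> R_star n H"
  unfolding R_star_def using assms finite_degenerate_polys
  by (intro card_inj_on_le[of \<phi>]) auto

text \<open>The even factor has a nonzero root \<open>x\<close> and also the root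
  \<open>- x\<close>; their quotient is \<open>-1\<close>.\<close>

lemma degenerate_even_quadratic_mult:
  fixes c a :: int
  assumes "c \<noteq> 0" "a \<noteq> 0"
  shows "degenerate (map_poly of_int ([:c, 0, a:] * g))"
proof -
  define x where "x = csqrt (- (of_int c / of_int a))"
  have x2: "x ^ 2 = - (of_int c / of_int a)" by (simp add: x_def)
  have x0: "x \<noteq> 0" using assms by (simp add: x_def)
  have "poly (map_poly of_int [:c, 0, a:]) y = 0" if "y ^ 2 = x ^ 2" for y :: complex
  proof -
    have "map_poly of_int [:c, 0, a:] = [:of_int c, 0, of_int a :: complex:]"
      by (rule poly_eqI) (simp add: coeff_map_poly coeff_pCons split: nat.splits)
    then have "poly (map_poly of_int [:c, 0, a:]) y = of_int c + of_int a * y ^ 2"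
      by (simp add: power2_eq_square)
    then show ?thesis using that x2 assms by simp
  qed
  then have root: "poly (map_poly of_int ([:c, 0, a:] * g)) y = 0" if "y ^ 2 = x ^ 2" for y :: complex
    using that by (simp only: of_int_poly_hom.hom_mult poly_mult) simp
  have "x \<noteq> - x" using x0 by simp
  moreover have "(x / - x) ^ 2 = 1" using x0 by simp
  ultimately show ?thesis
    unfolding degenerate_def using root[of x] root[of "- x"] zero_less_numeral[of num.One]
    by (metis power2_minus zero_less_numeral)
qed

section \<open>Coprime pairs and the explicit families\<close>

definition coprime_pairs :: "nat \<Rightarrow> (nat \<times> nat) set" where
  "coprime_pairs N = {(a, b). 1 \<le> b \<and> b \<le> a \<and> a \<le> N \<and> coprime a b}"

lemma finite_coprime_pairs: "finite (coprime_pairs N)"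
  by (rule finite_subset[of _ "{..N} \<times> {..N}"]) (auto simp: coprime_pairs_def)

text \<open>Every pair of positive integers is a multiple of a coprime pair, so the sum of \<open>1 / a\<^sup>2\<close>
  over all pairs \<open>b \<le> a \<le> N\<close>, which is harmonic, is at most \<open>\<Sum>g. 1 / g\<^sup>2 \<le> 2\<close> times the sum
  over coprime pairs.\<close>

lemma sum_coprime_pairs_ge: "harm N / 2 \<le> (\<Sum>(a, b)\<in>coprime_pairs N. 1 / real a ^ 2)"
proof -
  let ?X = "SIGMA a:{1..N}. {1..a}"
  define \<psi> :: "nat \<times> nat \<Rightarrow> nat \<times> nat \<times> nat"
    where "\<psi> = (\<lambda>(a, b). (gcd a b, a div gcd a b, b div gcd a b))"
  define w :: "nat \<times> nat \<times> nat \<Rightarrow> real" where "w = (\<lambda>(g, a, b). 1 / real g ^ 2 * (1 / real a ^ 2))"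
  have inj: "inj_on \<psi> ?X"
  proof (rule inj_onI, clarsimp simp: \<psi>_def)
    fix a b c d :: nat
    assume "gcd a b = gcd c d" "a div gcd c d = c div gcd c d" "b div gcd c d = d div gcd c d"
    then show "a = c \<and> b = d"
      by (metis dvd_mult_div_cancel gcd_dvd1 gcd_dvd2)
  qed
  have "harm N = (\<Sum>a=1..N. \<Sum>b=1..a. 1 / real a ^ 2)"
    unfolding harm_def by (intro sum.cong) (auto simp: power2_eq_square field_simps)
  also have "\<dots> = (\<Sum>(a, b)\<in>?X. 1 / real a ^ 2)" by (subst sum.Sigma) auto
  also have "\<dots> = (\<Sum>p\<in>?X. w (\<psi> p))"
  proof (rule sum.cong)
    fix p assume p: "p \<in> ?X"
    obtain a b where ab: "p = (a, b)" by (cases p)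
    have "real a = real (gcd a b) * real (a div gcd a b)"
      by (metis dvd_mult_div_cancel gcd_dvd1 of_nat_mult)
    then have "1 / real a ^ 2 = w (\<psi> p)"
      unfolding ab w_def \<psi>_def by (metis (no_types, lifting) case_prod_conv mult_1 power_mult_distrib times_divide_times_eq)
    then show "(case p of (a, b) \<Rightarrow> 1 / real a ^ 2) = w (\<psi> p)" by (simp add: ab)
  qed simp
  also have "\<dots> = (\<Sum>q\<in>\<psi> ` ?X. w q)" by (subst sum.reindex[OF inj]) simp
  also have "\<dots> \<le> (\<Sum>q\<in>{1..N} \<times> coprime_pairs N. w q)"
  proof (rule sum_mono2)
    show "finite ({1..N} \<times> coprime_pairs N)" using finite_coprime_pairs by simp
    show "\<psi> ` ?X \<subseteq> {1..N} \<times> coprime_pairs N"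
    proof (rule image_subsetI)
      fix p assume "p \<in> ?X"
      then obtain a b where p: "p = (a, b)" and ab: "1 \<le> b" "b \<le> a" "a \<le> N" by auto
      have g: "0 < gcd a b" "gcd a b \<le> b" using ab by (auto intro: gcd_le2_nat)
      have "0 < b div gcd a b" using g by (simp add: div_greater_zero_iff)
      moreover have "b div gcd a b \<le> a div gcd a b" using ab by (intro div_le_mono)
      moreover have "a div gcd a b \<le> N" using ab by (meson div_le_dividend le_trans)
      moreover have "coprime (a div gcd a b) (b div gcd a b)" using ab by (intro div_gcd_coprime) auto
      moreover have "1 \<le> gcd a b" "gcd a b \<le> N" using g ab by linarith+
      ultimately show "\<psi> p \<in> {1..N} \<times> coprime_pairs N"
        unfolding p \<psi>_def coprime_pairs_def prod.case by simp
    qed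
    show "\<And>q. q \<in> {1..N} \<times> coprime_pairs N - \<psi> ` ?X \<Longrightarrow> 0 \<le> w q" by (auto simp: w_def)
  qed
  also have "\<dots> = (\<Sum>g=1..N. 1 / real g ^ 2) * (\<Sum>(a, b)\<in>coprime_pairs N. 1 / real a ^ 2)"
    by (simp add: w_def sum_product sum.cartesian_product case_prod_unfold)
  also have "\<dots> \<le> 2 * (\<Sum>(a, b)\<in>coprime_pairs N. 1 / real a ^ 2)"
    by (intro mult_right_mono sum_inverse_squares_le sum_nonneg) auto
  finally show ?thesis by simp
qed

text \<open>Rounding down loses at most a factor 2 once the quotient is at least 1.\<close>

lemma real_div_ge_half:
  fixes H m :: nat
  assumes "1 \<le> m" "m \<le> H"
  shows "real H / (2 * real m) \<le> real (H div m)"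
proof -
  have "1 \<le> H div m" using assms by (simp add: Suc_le_eq div_greater_zero_iff)
  then have "m * 1 \<le> m * (H div m)" by (intro mult_le_mono2)
  moreover have "H = m * (H div m) + H mod m" by simp
  moreover have "H mod m < m" using assms by simp
  ultimately have "H \<le> 2 * (m * (H div m))" by linarith
  then have "real H \<le> 2 * (real m * real (H div m))"
    by (metis of_nat_le_iff of_nat_mult of_nat_numeral)
  then show ?thesis using assms by (simp add: divide_le_eq mult_ac)
qed

text \<open>The family \<open>(a X^2 + c) (r X + s)\<close> with \<open>a\<close>, \<open>c\<close>
  coprime, \<open>c \<le> a\<close> and \<open>r\<close>, \<open>s\<close> at most
  \<open>H div a\<close>. Summing \<open>(H div a) ^ 2\<close> over the coprime pairs produces the
  logarithm.\<close>

lemma R_star_3_lower: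
  assumes H: "2 \<le> H"
  shows "1 / 8 * (real H ^ 2 * ln (real H)) \<le> real (R_star 3 H)"
proof -
  define D where "D = (SIGMA p:coprime_pairs H. {1..H div fst p} \<times> {1..H div fst p})"
  define \<phi> :: "(nat \<times> nat) \<times> (nat \<times> nat) \<Rightarrow> int poly"
    where "\<phi> = (\<lambda>((a, c), (r, s)). [:int c, 0, int a:] * [:int s, int r:])"
  have \<phi>: "\<phi> ((a, c), (r, s)) = [:int (c * s), int (c * r), int (a * s), int (a * r):]" for a c r s
    by (simp add: \<phi>_def)
  have inj: "inj_on \<phi> D"
  proof (rule inj_onI)
    fix d d' assume d: "d \<in> D" "d' \<in> D" and eq: "\<phi> d = \<phi> d'"
    obtain a c r s a' c' r' s' where dd: "d = ((a, c), (r, s))" "d' = ((a', c'), (r', s'))"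
      by (metis prod.collapse)
    from eq have e: "c * s = c' * s'" "c * r = c' * r'" "a * s = a' * s'" "a * r = a' * r'"
      unfolding dd \<phi> by (auto simp del: of_nat_mult)
    have co: "coprime a c" "coprime a' c'" and pos: "0 < a" "0 < c" "0 < r" "0 < a'" "0 < c'" "0 < r'"
      using d by (auto simp: D_def dd coprime_pairs_def)
    \<comment> \<open>Coprimality recovers \<open>r\<close> as the gcd of the coefficients
      \<open>a * r\<close> and \<open>c * r\<close>.\<close>
    have "r = r * gcd a c" using co by simp
    also have "\<dots> = r' * gcd a' c'"
      unfolding gcd_mult_distrib_nat using e by (simp add: mult.commute)
    also have "\<dots> = r'" using co by simp
    finally have "r = r'" .
    then have "a = a'" "c = c'" using e pos by auto
    then have "s = s'" using e pos by auto
    then show "d = d'" using \<open>r = r'\<close> \<open>a = a'\<close> \<open>c = c'\<close> dd by simp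
  qed
  have "card D \<le> R_star 3 H"
  proof (rule card_le_R_star[OF inj])
    fix d assume d: "d \<in> D"
    obtain a c r s where dd: "d = ((a, c), (r, s))" by (metis prod.collapse)
    have p: "1 \<le> c" "c \<le> a" "1 \<le> r" "r \<le> H div a" "1 \<le> s" "s \<le> H div a"
      using d by (auto simp: D_def dd coprime_pairs_def)
    have "a * t \<le> H" if "t \<le> H div a" for t
      using that by (metis div_times_less_eq_dividend mult.commute mult_le_mono2 order_trans)
    then have ar: "a * r \<le> H" "a * s \<le> H" using p by auto
    moreover have "c * r \<le> a * r" "c * s \<le> a * s" using p by simp_all
    ultimately have cr: "c * r \<le> H" "c * s \<le> H" by linarith+
    have "\<bar>coeff (\<phi> d) j\<bar> \<le> int H" for j
      unfolding dd \<phi> using ar cr by (auto simp: coeff_pCons simp flip: of_nat_mult split: nat.splits)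
    moreover have "degenerate (map_poly of_int (\<phi> d))"
      unfolding dd \<phi>_def prod.case using p by (intro degenerate_even_quadratic_mult) auto
    moreover have "degree (\<phi> d) = 3" "coeff (\<phi> d) 3 \<noteq> 0"
      unfolding dd \<phi> using p by (auto simp: numeral_3_eq_3)
    moreover have "reducible_over_rat (\<phi> d)"
      unfolding dd \<phi>_def prod.case using p by (intro reducible_over_rat_mult) auto
    ultimately show "\<phi> d \<in> degenerate_polys 3 H \<and> reducible_over_rat (\<phi> d)"
      by (simp add: degenerate_polys_def)
  qed
  have "ln (real H) \<le> harm H" using ln_le_harm[of H] ln_mono[of "real H" "real H + 1"] H by linarith
  \<comment> \<open>The factor \<open>1 / 4\<close> pays for rounding two quotients,
    \<open>1 / 2\<close> for restricting to coprime pairs.\<close>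
  then have "1 / 8 * (real H ^ 2 * ln (real H)) \<le> real H ^ 2 / 4 * (harm H / 2)"
    by (simp add: mult_left_mono)
  also have "\<dots> \<le> real H ^ 2 / 4 * (\<Sum>(a, c)\<in>coprime_pairs H. 1 / real a ^ 2)"
    by (intro mult_left_mono sum_coprime_pairs_ge) auto
  also have "\<dots> = (\<Sum>p\<in>coprime_pairs H. (real H / (2 * real (fst p))) ^ 2)"
    unfolding sum_distrib_left by (intro sum.cong) (auto simp: power_divide power_mult_distrib)
  also have "\<dots> \<le> (\<Sum>p\<in>coprime_pairs H. real (H div fst p) ^ 2)"
    by (intro sum_mono power_mono real_div_ge_half) (auto simp: coprime_pairs_def)
  also have "\<dots> = real (card D)"
    unfolding D_def by (subst card_SigmaI) (auto simp: finite_coprime_pairs power2_eq_square)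
  also have "\<dots> \<le> real (R_star 3 H)" using \<open>card D \<le> R_star 3 H\<close> by simp
  finally show ?thesis .
qed

text \<open>The family \<open>g (a X - c) (a X + c)\<close> with \<open>a\<close>, \<open>c\<close>
  coprime, \<open>c \<le> a\<close> and \<open>g\<close> at most \<open>H div a ^ 2\<close>.\<close>

lemma R_star_2_lower:
  assumes H: "2 \<le> H"
  shows "1 / 8 * (real H * ln (real H)) \<le> real (R_star 2 H)"
proof -
  \<comment> \<open>For \<open>a \<le> N\<close> the quotient \<open>H div a ^ 2\<close> is at least
    1, as the rounding estimate needs. The price is \<open>ln (sqrt H)\<close>, half of
    \<open>ln H\<close>.\<close>
  define N where "N = nat \<lfloor>sqrt (real H)\<rfloor>"
  have N: "real N \<le> sqrt (real H)" "sqrt (real H) \<le> real N + 1"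
    unfolding N_def by (auto simp: of_nat_nat)
  have "real N ^ 2 \<le> sqrt (real H) ^ 2" by (intro power_mono N) simp
  then have "real (N ^ 2) \<le> real H" by simp
  then have NH: "N ^ 2 \<le> H" by (simp only: of_nat_le_iff)
  have sq: "a ^ 2 \<le> H" if "a \<le> N" for a by (rule order_trans[OF power_mono[OF that] NH]) simp
  define D where "D = (SIGMA p:coprime_pairs N. {1..H div fst p ^ 2})"
  define \<phi> :: "(nat \<times> nat) \<times> nat \<Rightarrow> int poly"
    where "\<phi> = (\<lambda>((a, c), g). [:- int (g * c ^ 2), 0, int (g * a ^ 2):])"
  have inj: "inj_on \<phi> D"
  proof (rule inj_onI)
    fix d d' assume d: "d \<in> D" "d' \<in> D" and eq: "\<phi> d = \<phi> d'"
    obtain a c g a' c' g' where dd: "d = ((a, c), g)" "d' = ((a', c'), g')"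
      by (metis prod.collapse)
    from eq have e: "g * c ^ 2 = g' * c' ^ 2" "g * a ^ 2 = g' * a' ^ 2"
      unfolding dd \<phi>_def by (auto simp del: of_nat_mult of_nat_power)
    have co: "coprime (a ^ 2) (c ^ 2)" "coprime (a' ^ 2) (c' ^ 2)" and pos: "0 < g" "0 < g'"
      using d by (auto simp: D_def dd coprime_pairs_def)
    \<comment> \<open>As in degree 3, the gcd of the two nonzero coefficients recovers
      \<open>g\<close>, up to sign.\<close>
    have "g = g * gcd (a ^ 2) (c ^ 2)" using co by simp
    also have "\<dots> = g' * gcd (a' ^ 2) (c' ^ 2)" unfolding gcd_mult_distrib_nat by (simp only: e)
    also have "\<dots> = g'" using co by simp
    finally have "g = g'" .
    moreover from this have "a ^ 2 = a' ^ 2" "c ^ 2 = c' ^ 2" using e pos by auto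
    ultimately show "d = d'" by (simp add: dd)
  qed
  have "card D \<le> R_star 2 H"
  proof (rule card_le_R_star[OF inj])
    fix d assume d: "d \<in> D"
    obtain a c g where dd: "d = ((a, c), g)" by (metis prod.collapse)
    have p: "1 \<le> c" "c \<le> a" "1 \<le> g" "g \<le> H div a ^ 2"
      using d by (auto simp: D_def dd coprime_pairs_def)
    have ga: "g * a ^ 2 \<le> H"
      using p(4) by (metis div_times_less_eq_dividend mult_le_mono1 order_trans)
    moreover have "g * c ^ 2 \<le> g * a ^ 2" using p by (intro mult_le_mono2 power_mono) auto
    ultimately have gc: "g * c ^ 2 \<le> H" by linarith
    have "\<bar>coeff (\<phi> d) j\<bar> \<le> int H" for j
      unfolding dd \<phi>_def using ga gc
      by (auto simp: coeff_pCons simp del: of_nat_mult of_nat_power split: nat.splits)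
    moreover have "degenerate (map_poly of_int (\<phi> d))"
      using degenerate_even_quadratic_mult[of "- int (g * c ^ 2)" "int (g * a ^ 2)" 1] p
      unfolding dd \<phi>_def prod.case by simp
    moreover have "degree (\<phi> d) = 2" "coeff (\<phi> d) 2 \<noteq> 0"
      unfolding dd \<phi>_def using p by (auto simp: numeral_2_eq_2)
    moreover have "\<phi> d = [:- int (g * c), int (g * a):] * [:int c, int a:]"
      unfolding dd \<phi>_def by (simp add: power2_eq_square algebra_simps)
    then have "reducible_over_rat (\<phi> d)"
      using p by (simp only:) (intro reducible_over_rat_mult; simp)
    ultimately show "\<phi> d \<in> degenerate_polys 2 H \<and> reducible_over_rat (\<phi> d)"
      by (simp add: degenerate_polys_def)
  qed
  have "ln (real H) / 2 = ln (sqrt (real H))" using H by (simp add: ln_sqrt)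
  also have "\<dots> \<le> ln (real N + 1)" using N H by (intro ln_mono) auto
  also have "\<dots> \<le> harm N" by (rule ln_le_harm)
  finally have "real H / 4 * (ln (real H) / 2) \<le> real H / 4 * harm N"
    by (intro mult_left_mono) auto
  then have "1 / 8 * (real H * ln (real H)) \<le> real H / 2 * (harm N / 2)" by simp
  also have "\<dots> \<le> real H / 2 * (\<Sum>(a, c)\<in>coprime_pairs N. 1 / real a ^ 2)"
    by (intro mult_left_mono sum_coprime_pairs_ge) auto
  also have "\<dots> = (\<Sum>p\<in>coprime_pairs N. real H / (2 * real (fst p ^ 2)))"
    unfolding sum_distrib_left by (intro sum.cong) auto
  also have "\<dots> \<le> (\<Sum>p\<in>coprime_pairs N. real (H div fst p ^ 2))"
    using sq by (intro sum_mono real_div_ge_half) (auto simp: coprime_pairs_def)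
  also have "\<dots> = real (card D)"
    unfolding D_def by (subst card_SigmaI) (auto simp: finite_coprime_pairs)
  also have "\<dots> \<le> real (R_star 2 H)" using \<open>card D \<le> R_star 2 H\<close> by simp
  finally show ?thesis .
qed

text \<open>A cofactor of \<open>X^2 + 1\<close> has \<open>n - 1\<close> coefficients, chosen
  between 1 and \<open>H div 2\<close>. Each coefficient of the product is a sum of at most two of
  them, so it stays below the bound, and positivity keeps the leading one nonzero.\<close>

lemma R_star_lower:
  assumes n: "3 \<le> n" and H: "2 \<le> H"
  shows "1 / 4 ^ (n - 1) * real H ^ (n - 1) \<le> real (R_star n H)"
proof -
  define D where "D = (\<Pi>\<^sub>E i\<in>{..n - 2}. {1..H div 2})"
  define g :: "(nat \<Rightarrow> nat) \<Rightarrow> int poly" where "g = (\<lambda>e. \<Sum>i\<le>n - 2. monom (int (e i)) i)"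
  have cg: "coeff (g e) i = (if i \<le> n - 2 then int (e i) else 0)" for e i
    by (simp add: g_def coeff_sum sum.delta')
  let ?q = "[:1, 0, 1:] :: int poly"
  have inj: "inj_on (\<lambda>e. ?q * g e) D"
  proof (rule inj_onI)
    fix e e' assume e: "e \<in> D" "e' \<in> D" "?q * g e = ?q * g e'"
    have "?q \<noteq> 0" by simp
    then have "g e = g e'" using e(3) mult_left_cancel by blast
    then have "e i = e' i" if "i \<in> {..n - 2}" for i using that cg[of e i] cg[of e' i] by simp
    then show "e = e'" using e(1,2) unfolding D_def by (rule PiE_ext[rotated 2]) auto
  qed
  have "card D \<le> R_star n H"
  proof (rule card_le_R_star[OF inj])
    fix e assume e: "e \<in> D"
    have ei: "1 \<le> e i" "e i \<le> H div 2" if "i \<le> n - 2" for i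
      using e that by (auto simp: D_def PiE_iff)
    have bd: "0 \<le> coeff (g e) i \<and> coeff (g e) i \<le> int (H div 2)" for i
      using ei by (simp add: cg)
    have cf: "coeff (?q * g e) j = coeff (g e) j + (if 2 \<le> j then coeff (g e) (j - 2) else 0)" for j
      by (auto simp: coeff_pCons numeral_2_eq_2 split: nat.splits)
    have "\<bar>coeff (?q * g e) j\<bar> \<le> int H" for j
    proof -
      have "0 \<le> coeff (?q * g e) j \<and> coeff (?q * g e) j \<le> 2 * int (H div 2)"
        unfolding cf using bd[of j] bd[of "j - 2"] by auto
      then show ?thesis by linarith
    qed
    moreover have "degenerate (map_poly of_int (?q * g e))"
      by (rule degenerate_even_quadratic_mult) auto
    moreover have lead: "coeff (g e) (n - 2) \<noteq> 0" using ei[of "n - 2"] by (simp add: cg)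
    then have dg: "degree (g e) = n - 2" by (intro antisym degree_le le_degree) (auto simp: cg)
    have "g e \<noteq> 0" using lead by auto
    then have "degree (?q * g e) = n" using dg n by (subst degree_mult_eq) auto
    moreover from this have "coeff (?q * g e) n \<noteq> 0"
      unfolding cf using lead n by (simp add: cg)
    moreover have "reducible_over_rat (?q * g e)"
      using dg n by (intro reducible_over_rat_mult) auto
    ultimately show "?q * g e \<in> degenerate_polys n H \<and> reducible_over_rat (?q * g e)"
      by (simp only: degenerate_polys_def mem_Collect_eq) simp
  qed
  have "1 / 4 ^ (n - 1) * real H ^ (n - 1) = (real H / (2 * real 2)) ^ (n - 1)"
    by (simp add: power_divide)
  also have "\<dots> \<le> real (H div 2) ^ (n - 1)"
    using H by (intro power_mono real_div_ge_half) auto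
  also have "\<dots> = real (card D)"
  proof -
    have "Suc (n - 2) = n - 1" using n by simp
    then show ?thesis by (simp add: D_def card_PiE flip: power_Suc)
  qed
  also have "\<dots> \<le> real (R_star n H)" using \<open>card D \<le> R_star n H\<close> by simp
  finally show ?thesis .
qed

section \<open>The quadratic case\<close>

text \<open>A root of unity has absolute value 1, so the two rational roots agree in absolute value;
  being distinct, they are opposite.\<close>

lemma linear_roots_ratio:
  fixes a b c d :: int and x y :: complex
  assumes x: "of_int b + of_int a * x = 0" "a \<noteq> 0" and y: "of_int d + of_int c * y = 0" "c \<noteq> 0"
    and "x \<noteq> y" and k: "(x / y) ^ k = 1" "0 < k"
  shows "b * c = - (a * d)" "b \<noteq> 0"
proof -
  have xy: "x = - of_int b / of_int a" "y = - of_int d / of_int c"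
    using x y by (simp_all add: field_simps add_eq_0_iff)
  have nz: "x \<noteq> 0" "y \<noteq> 0" using k by (auto simp: power_0_left)
  then show "b \<noteq> 0" using xy by auto
  have "cmod (x / y) ^ k = 1" using k by (metis norm_one norm_power)
  then have "cmod (x / y) = 1" using power_eq_imp_eq_base[of "cmod (x / y)" k 1] k by simp
  then have "cmod x = cmod y" using nz by (simp add: norm_divide)
  then have "\<bar>real_of_int b\<bar> / \<bar>real_of_int a\<bar> = \<bar>real_of_int d\<bar> / \<bar>real_of_int c\<bar>"
    by (simp add: xy norm_divide)
  then have "\<bar>real_of_int b\<bar> * \<bar>real_of_int c\<bar> = \<bar>real_of_int a\<bar> * \<bar>real_of_int d\<bar>"
    using x y by (simp add: field_simps)
  then have "real_of_int \<bar>b * c\<bar> = real_of_int \<bar>a * d\<bar>" by (simp add: abs_mult)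
  then have "\<bar>b * c\<bar> = \<bar>a * d\<bar>" by (simp only: of_int_eq_iff)
  moreover have "b * c \<noteq> a * d"
  proof
    assume "b * c = a * d"
    then have "of_int b * of_int c = (of_int a * of_int d :: complex)" by (simp flip: of_int_mult)
    then have "x = y" using x y by (simp add: xy field_simps)
    then show False using \<open>x \<noteq> y\<close> by simp
  qed
  ultimately show "b * c = - (a * d)" by linarith
qed

text \<open>Dividing \<open>a\<close>, \<open>b\<close> by their gcd \<open>g\<close> writes the
  factors as \<open>g (u X + v)\<close> and \<open>e (u X - v)\<close>, so
  \<open>m = g * e\<close>.\<close>

lemma proportional_linear_factors:
  fixes a b c d :: int
  assumes bc: "b * c = - (a * d)" and "a \<noteq> 0" "b \<noteq> 0"
  obtains m u v where "[:b, a:] * [:d, c:] = [:- (m * v ^ 2), 0, m * u ^ 2:]" "u \<noteq> 0" "v \<noteq> 0"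
proof -
  have "gcd a b \<noteq> 0" using assms by simp
  then obtain u v where "a = u * gcd a b" "b = v * gcd a b" and co: "coprime u v"
    using gcd_coprime_exists by blast
  then obtain g where ab: "a = u * g" "b = v * g" by blast
  have nz: "g \<noteq> 0" "u \<noteq> 0" "v \<noteq> 0" using ab assms by auto
  have "g * (v * c) = g * - (u * d)" using bc by (simp add: ab algebra_simps)
  then have vc: "v * c = - (u * d)" using mult_left_cancel[OF nz(1)] by blast
  then have "u dvd v * c" by simp
  then have "u dvd c" using co by (simp add: coprime_dvd_mult_right_iff)
  then obtain e where e: "c = u * e" by blast
  have "u * d = u * - (v * e)" using vc by (simp add: e algebra_simps)
  then have d: "d = - (v * e)" using mult_left_cancel[OF nz(2)] by blast
  have "[:b, a:] * [:d, c:] = [:- (g * e * v ^ 2), 0, g * e * u ^ 2:]"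
    by (simp add: ab d e power2_eq_square algebra_simps)
  then show ?thesis using that nz by blast
qed

text \<open>Both factors are linear and have one root each, so the two roots of the degenerate pair
  belong to different factors.\<close>

lemma degenerate_polys_2_form:
  assumes f: "f \<in> degenerate_polys 2 H" "reducible_over_rat f"
  obtains m u v where "f = [:- (m * v ^ 2), 0, m * u ^ 2:]" "u \<noteq> 0" "v \<noteq> 0"
proof -
  let ?c = "\<lambda>f. map_poly of_int f :: complex poly"
  obtain x y k where xy: "poly (?c f) x = 0" "poly (?c f) y = 0" "x \<noteq> y" "0 < k" "(x / y) ^ k = 1"
    using f by (auto simp: degenerate_polys_def degenerate_def)
  have nz: "x \<noteq> 0" "y \<noteq> 0" using xy(4,5) by (auto simp: power_0_left)
  obtain p q where pq: "f = p * q" "0 < degree p" "0 < degree q"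
    using reducible_over_rat_factor[OF f(2)] by blast
  have "degree p + degree q = 2"
    using degree_eq_if_degenerate_polys[OF f(1)] pq by (metis degree_0 degree_mult_eq less_numeral_extra(3))
  then have "degree p = 1" "degree q = 1" using pq by auto
  then obtain a b c d where ab: "p = [:b, a:]" "a \<noteq> 0" "q = [:d, c:]" "c \<noteq> 0"
    by (metis One_nat_def degree1_coeffs)
  have lin: "poly (?c [:s, r:]) z = of_int s + of_int r * z" for r s z
  proof -
    have "?c [:s, r:] = [:of_int s, of_int r:]"
      by (rule poly_eqI) (simp add: coeff_map_poly coeff_pCons split: nat.splits)
    then show ?thesis by simp
  qed
  have root: "of_int b + of_int a * z = 0 \<or> of_int d + of_int c * z = 0" if "poly (?c f) z = 0" for z
    using that unfolding pq(1) ab of_int_poly_hom.hom_mult poly_mult lin by simp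
  have one: "z = w" if "of_int s + of_int r * z = 0" "of_int s + of_int r * w = 0" "r \<noteq> 0"
    for r s :: int and z w :: complex
    proof -
    have "of_int r * z = of_int r * w" using that(1,2) by (metis add_left_cancel)
    then show ?thesis using that(3) by simp
  qed
  have yx: "(y / x) ^ k = 1" using xy(5) nz by (simp add: power_divide)
  consider "of_int b + of_int a * x = 0" "of_int d + of_int c * y = 0"
    | "of_int b + of_int a * y = 0" "of_int d + of_int c * x = 0"
  proof -
    have "\<not> (of_int b + of_int a * x = 0 \<and> of_int b + of_int a * y = 0)"
      using one[of b a x y] ab xy(3) by auto
    moreover have "\<not> (of_int d + of_int c * x = 0 \<and> of_int d + of_int c * y = 0)"
      using one[of d c x y] ab xy(3) by auto
    ultimately show thesis using root[OF xy(1)] root[OF xy(2)] that by argo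
  qed
  then have bc: "b * c = - (a * d) \<and> b \<noteq> 0"
  proof cases
    case 1
    show ?thesis
      using linear_roots_ratio[OF 1(1) ab(2) 1(2) ab(4) xy(3) xy(5,4)] by auto
  next
    case 2
    show ?thesis
      using linear_roots_ratio[OF 2(1) ab(2) 2(2) ab(4) xy(3)[symmetric] yx xy(4)] by auto
  qed
  show thesis
  proof (rule proportional_linear_factors[OF conjunct1[OF bc] ab(2) conjunct2[OF bc]])
    fix m u v assume "[:b, a:] * [:d, c:] = [:- (m * v ^ 2), 0, m * u ^ 2:]" "u \<noteq> 0" "v \<noteq> 0"
    then show thesis using that[of m v u] unfolding pq(1) ab by simp
  qed
qed

text \<open>The square is covered by two triangles that meet in the diagonal; in each, the value
  \<open>F u\<close> occurs \<open>u\<close> times.\<close>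

lemma sum_max_le:
  fixes F :: "nat \<Rightarrow> real"
  assumes F: "\<And>u. 0 \<le> F u"
  shows "(\<Sum>u=1..N. \<Sum>v=1..N. F (max u v)) \<le> 2 * (\<Sum>u=1..N. real u * F u)"
proof -
  have *: "(\<Sum>u=1..N. \<Sum>v=1..N. if v \<le> u then F u else 0) = (\<Sum>u=1..N. real u * F u)"
  proof (rule sum.cong)
    fix u assume u: "u \<in> {1..N}"
    have "(\<Sum>v=1..N. if v \<le> u then F u else 0) = (\<Sum>v=1..u. F u)"
      using u by (intro sum.mono_neutral_cong_right) auto
    then show "(\<Sum>v=1..N. if v \<le> u then F u else 0) = real u * F u" by simp
  qed simp
  have "(\<Sum>u=1..N. \<Sum>v=1..N. F (max u v))
      \<le> (\<Sum>u=1..N. \<Sum>v=1..N. (if v \<le> u then F u else 0) + (if u \<le> v then F v else 0))"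
    using F by (intro sum_mono) (auto simp: max_def)
  also have "\<dots> = (\<Sum>u=1..N. \<Sum>v=1..N. if v \<le> u then F u else 0)
      + (\<Sum>u=1..N. \<Sum>v=1..N. if u \<le> v then F v else 0)"
    by (simp only: sum.distrib)
  also have "(\<Sum>u=1..N. \<Sum>v=1..N. if u \<le> v then F v else 0)
      = (\<Sum>u=1..N. \<Sum>v=1..N. if v \<le> u then F u else 0)"
    by (rule sum.swap)
  finally show ?thesis using * by simp
qed

text \<open>Triples \<open>(u, v, m)\<close> with
  \<open>\<bar>m\<bar> * (max u v) ^ 2 \<le> H\<close> cover all polynomials in question. Different
  triples may give the same one, which is harmless for an upper bound.\<close>

lemma R_star_2_upper:
  assumes H: "2 \<le> H"
  shows "real (R_star 2 H) \<le> 12 * (real H * ln (real H))"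
proof -
  define I where "I = (\<lambda>u v. {- int (H div (max u v) ^ 2)..int (H div (max u v) ^ 2)} - {0})"
  define E where "E = (SIGMA p:{1..H} \<times> {1..H}. I (fst p) (snd p))"
  define \<phi> :: "(nat \<times> nat) \<times> int \<Rightarrow> int poly"
    where "\<phi> = (\<lambda>((u, v), m). [:- (m * int v ^ 2), 0, m * int u ^ 2:])"
  have "{f \<in> degenerate_polys 2 H. reducible_over_rat f} \<subseteq> \<phi> ` E"
  proof
    fix f assume "f \<in> {f \<in> degenerate_polys 2 H. reducible_over_rat f}"
    then have f: "f \<in> degenerate_polys 2 H" "reducible_over_rat f" by auto
    obtain m u v where muv: "f = [:- (m * v ^ 2), 0, m * u ^ 2:]" "u \<noteq> 0" "v \<noteq> 0"
      using degenerate_polys_2_form[OF f] by metis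
    define u' v' where "u' = nat \<bar>u\<bar>" and "v' = nat \<bar>v\<bar>"
    have u': "int u' ^ 2 = u ^ 2" "int v' ^ 2 = v ^ 2" "1 \<le> u'" "1 \<le> v'"
      using muv by (auto simp: u'_def v'_def)
    have c: "coeff f 2 \<noteq> 0" "\<bar>coeff f j\<bar> \<le> int H" if "j \<le> 2" for j
      using f that by (auto simp: degenerate_polys_def)
    have m0: "m \<noteq> 0" using c(1)[of 0] muv(1) by (auto simp: numeral_2_eq_2)
    have mu: "nat \<bar>m\<bar> * w ^ 2 \<le> H" if "w \<in> {u', v'}" for w
    proof -
      have "\<bar>m * int w ^ 2\<bar> \<le> int H"
        using that c(2)[of 0] c(2)[of 2] u' muv(1) by (auto simp: numeral_2_eq_2 abs_mult)
      then have "int (nat \<bar>m\<bar> * w ^ 2) \<le> int H" by (simp add: abs_mult)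
      then show ?thesis by (simp only: of_nat_le_iff)
    qed
    have le: "w \<le> H" if w: "w \<in> {u', v'}" for w
    proof -
      have "1 * w \<le> nat \<bar>m\<bar> * w ^ 2"
        using m0 u' w by (intro mult_le_mono self_le_power) auto
      with mu[OF w] show ?thesis by linarith
    qed
    have "nat \<bar>m\<bar> * (max u' v') ^ 2 \<le> H" using mu by (auto simp: max_def)
    then have "nat \<bar>m\<bar> \<le> H div (max u' v') ^ 2"
      using u' by (simp add: less_eq_div_iff_mult_less_eq)
    then have "m \<in> I u' v'" using m0 by (auto simp: I_def)
    then have "((u', v'), m) \<in> E" using u' le by (auto simp: E_def)
    moreover have "f = \<phi> ((u', v'), m)" by (simp add: \<phi>_def muv(1) u')
    ultimately show "f \<in> \<phi> ` E" by blast
  qed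
  moreover have "finite E" by (simp add: E_def I_def)
  ultimately have "R_star 2 H \<le> card E"
    unfolding R_star_def by (rule surj_card_le[rotated])
  also have "card E = (\<Sum>u=1..H. \<Sum>v=1..H. 2 * (H div (max u v) ^ 2))"
  proof -
    have "card (I u v) = 2 * (H div (max u v) ^ 2)" for u v
      unfolding I_def by (subst card_Diff_singleton) auto
    then show ?thesis
      unfolding E_def by (subst card_SigmaI) (auto simp: I_def sum.cartesian_product case_prod_unfold)
  qed
  finally have "real (R_star 2 H) \<le> real (\<Sum>u=1..H. \<Sum>v=1..H. 2 * (H div (max u v) ^ 2))"
    by (simp only: of_nat_le_iff)
  also have "\<dots> \<le> (\<Sum>u=1..H. \<Sum>v=1..H. 2 * (real H / real ((max u v) ^ 2)))"
    unfolding of_nat_sum of_nat_mult of_nat_numeral by (intro sum_mono mult_left_mono of_nat_div_le_of_nat) auto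
  also have "\<dots> \<le> 2 * (\<Sum>u=1..H. real u * (2 * (real H / real (u ^ 2))))"
    by (rule sum_max_le) simp
  also have "(\<Sum>u=1..H. real u * (2 * (real H / real (u ^ 2)))) = 2 * real H * harm H"
    unfolding harm_def sum_distrib_left by (intro sum.cong) (auto simp: field_simps power2_eq_square)
  \<comment> \<open>\<open>harm H \<le> 1 + ln H \<le> 3 * ln H\<close>. In
    \<open>12 = 2 * 2 * 3\<close> the other factors are the two triangles and the sign of
    \<open>m\<close>.\<close>
  also have "2 * (2 * real H * harm H) \<le> 2 * (2 * real H * (3 * ln (real H)))"
    using harm_le[of H] ln_ge_half[OF H] H by (intro mult_left_mono) auto
  also have "\<dots> = 12 * (real H * ln (real H))" by simp
  finally show ?thesis .
qed

theorem theorem5p2: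
  "\<exists>c C :: nat \<Rightarrow> real.
     (\<forall>n\<ge>2. c n > 0 \<and> C n > 0) \<and>
     (\<forall>H::nat. H \<ge> 2 \<longrightarrow>
        c 2 * (real H * ln (real H)) \<le> real (R_star 2 H) \<and>
        real (R_star 2 H) \<le> C 2 * (real H * ln (real H))) \<and>
     (\<forall>H::nat. H \<ge> 2 \<longrightarrow>
        c 3 * (real H ^ 2 * ln (real H)) \<le> real (R_star 3 H) \<and>
        real (R_star 3 H) \<le> C 3 * (real H ^ 2 * ln (real H))) \<and>
     (\<forall>n H::nat. n \<ge> 4 \<longrightarrow> H \<ge> 2 \<longrightarrow>
        c n * real H ^ (n - 1) \<le> real (R_star n H) \<and>
        real (R_star n H) \<le> C n * real H ^ (n - 1))"
proof -
  obtain C3 where C3: "0 < C3" "\<And>H. 2 \<le> H \<Longrightarrow> real (R_star 3 H) \<le> C3 * (real H ^ 2 * ln (real H))"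
    using R_star_3_upper by blast
  \<comment> \<open>Choice turns the constants, which exist for each \<open>n\<close> uniformly in
    \<open>H\<close>, into a function of \<open>n\<close>.\<close>
  obtain D where D: "\<And>n. 4 \<le> n \<Longrightarrow> 0 < D n"
    "\<And>n H. 4 \<le> n \<Longrightarrow> real (R_star n H) \<le> D n * real H ^ (n - 1)"
    using R_star_upper_ge_4 by metis
  define c :: "nat \<Rightarrow> real" where "c = (\<lambda>n. if n \<le> 3 then 1 / 8 else 1 / 4 ^ (n - 1))"
  define C where "C = (\<lambda>n. if n = 2 then 12 else if n = 3 then C3 else D n)"
  show ?thesis
  proof (rule exI[of _ c], rule exI[of _ C], intro conjI allI impI)
    fix n :: nat assume "2 \<le> n"
    show "0 < c n" by (simp add: c_def)
    show "0 < C n" using C3(1) D(1)[of n] \<open>2 \<le> n\<close> by (simp add: C_def)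
  next
    fix H :: nat assume H: "2 \<le> H"
    show "c 2 * (real H * ln (real H)) \<le> real (R_star 2 H)"
      "real (R_star 2 H) \<le> C 2 * (real H * ln (real H))"
      using R_star_2_lower[OF H] R_star_2_upper[OF H] by (simp_all add: c_def C_def)
    show "c 3 * (real H ^ 2 * ln (real H)) \<le> real (R_star 3 H)"
      "real (R_star 3 H) \<le> C 3 * (real H ^ 2 * ln (real H))"
      using R_star_3_lower[OF H] C3(2)[OF H] by (simp_all add: c_def C_def)
  next
    fix n H :: nat assume n: "4 \<le> n" and H: "2 \<le> H"
    show "c n * real H ^ (n - 1) \<le> real (R_star n H)"
      using R_star_lower[of n H] n H by (simp add: c_def)
    show "real (R_star n H) \<le> C n * real H ^ (n - 1)"
      using D(2)[OF n, of H] n by (simp add: C_def)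
  qed
qed

end
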